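(* Suppose $F,q,\phi$ satisfy the Lipschitz and growth hypothesis (H) stated in the context. Then the value functional $V$ of the control problem is a viscosity solution (in the sense defined in the context) of the path-dependent Hamilton-Jacobi-Bellman equation $$\partial_t V(\gamma_t)+\mathbf H(\gamma_t,\partial_xV(\gamma_t))=0,\quad (t,\gamma_t)\in[0,T)\times\Lambda;\qquad V(\gamma_T)=\phi(\gamma_T),\quad \gamma_T\in\Lambda_T,$$ where $\mathbf H(\gamma_t,p)=\inf_{u\in U}[(p,F(\gamma_t,u))_{R^d}+q(\gamma_t,u)]$.
   Context: Paths. Fix $T>0$ and $d\ge1$. For $t\in[0,T]$, $\hat\Lambda_t$ is the set of càdlàg functions $[0,t]\to R^d$ and $\Lambda_t=C([0,t];R^d)$; $\hat\Lambda^t=\bigcup_{s\in[t,T]}\hat\Lambda_s$, $\Lambda^t=\bigcup_{s\in[t,T]}\Lambda_s$, $\hat\Lambda=\hat\Lambda^0$, $\Lambda=\Lambda^0$. A path in $\hat\Lambda_t$ is written $\gamma_t$ (the subscript is the final time), with value $\gamma_t(s)$ at $s\le t$; $(s,\gamma_s)\in[t,T]\times\Lambda^t$ means $s\in[t,T]$, $\gamma_s\in\Lambda_s$ (similarly for $\hat\Lambda^t$). For $t\le\bar t\le T$, $\gamma_{t,\bar t}\in\hat\Lambda_{\bar t}$ equals $\gamma_t$ on $[0,t]$ and $\gamma_t(t)$ on $(t,\bar t]$; for $x\in R^d$, $\gamma_t^x$ equals $\gamma_t$ on $[0,t)$ and $\gamma_t(t)+x$ at $t$. $\|\gamma_t\|_0=\sup_{0\le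 s\le t}|\gamma_t(s)|$ and, for $t\le\bar t$, $d_\infty(\gamma_t,\bar\gamma_{\bar t})=|t-\bar t|+\sup_{0\le s\le\bar t}|\gamma_{t,\bar t}(s)-\bar\gamma_{\bar t}(s)|$ (extended symmetrically). Derivatives. For $f:\hat\Lambda^t\to R$: the horizontal derivative is $\partial_tf(\gamma_s)=\lim_{h\downarrow0}\frac1h[f(\gamma_{s,s+h})-f(\gamma_s)]$ for $s<T$, and $\partial_tf(\gamma_T)=\lim_{s\uparrow T,\,s<T}\partial_tf(\gamma_T|_{[0,s]})$; the vertical derivative is $\partial_xf=(\partial_{x_1}f,\dots,\partial_{x_d}f)$, $\partial_{x_i}f(\gamma_s)=\lim_{h\to0}\frac1h[f(\gamma_s^{he_i})-f(\gamma_s)]$, $e_i$ the standard basis. $C^0(\hat\Lambda^t)$, $C^0(\Lambda^t)$ are the $d_\infty$-continuous real functionals. $C^1(\hat\Lambda^t)$ is the set of $f\in C^0(\hat\Lambda^t)$ such that $\partial_tf,\partial_{x_1}f,\dots,\partial_{x_d}f$ exist on all of $\hat\Lambda^t$ and lie in $C^0(\hat\Lambda^t)$. $f\in C^1(\Lambda^t)$ means $f$ is the restriction to $\Lambda^t$ of some $\hat f\in C^1(\hat\Lambda^t)$; then $\partial_tf:=\partial_t\hat f$, $\partial_xf:=\partial_x\hat f$ on $\Lambda^t$ (independent of the choice of $\hat f$). Control problem. $(U,d)$ is a metric space; $\mathcal U[t,T]$ is the set of measurable $u(\cdot):[t,T]\to U$. Hypothesis (H): $F:\Lambda\times U\to R^d$,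 $q:\Lambda\times U\to R$, $\phi:\Lambda_T\to R$ are continuous and for some $L>0$, for all $t\in[0,T]$, $\gamma_t,\gamma'_t\in\Lambda_t$, $u\in U$, $\eta_T,\eta'_T\in\Lambda_T$: $|F(\gamma_t,u)-F(\gamma'_t,u)|\vee|q(\gamma_t,u)-q(\gamma'_t,u)|\le L\|\gamma_t-\gamma'_t\|_0$; $|F(\gamma_t,u)|\vee|q(\gamma_t,u)|\le L(1+\|\gamma_t\|_0)$; $|\phi(\eta_T)-\phi(\eta'_T)|\le L\|\eta_T-\eta'_T\|_0$; $|\phi(\eta_T)|\le L(1+\|\eta_T\|_0)$. For $u(\cdot)\in\mathcal U[t,T]$, $X^{\gamma_t,u}:[0,T]\to R^d$ is the unique solution of $\dot X(s)=F(X_s,u(s))$, $s\in[t,T]$, $X_t=\gamma_t\in\Lambda_t$ (i.e. $X(s)=\gamma_t(t)+\int_t^sF(X_\sigma,u(\sigma))d\sigma$), where $X_s=X|_{[0,s]}$. $V(\gamma_t)=\inf_{u(\cdot)\in\mathcal U[t,T]}\big[\int_t^Tq(X^{\gamma_t,u}_\sigma,u(\sigma))d\sigma+\phi(X^{\gamma_t,u}_T)\big]$. Viscosity solutions. For $\mu,M_0>0$, $\mathcal C^\mu_{t,M_0}=\{\gamma_s\in\Lambda^t:\|\gamma_s\|_0\le M_0,\ \sup_{0\le l<r\le s}\frac{|\gamma_s(l)-\gamma_s(r)|}{|l-r|}\le\mu(1+M_0)\}$, $\mathcal C^\mu_{M_0}=\mathcal C^\mu_{0,M_0}$. For $w\in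 C^0(\Lambda)$, $J^+_{\mu,M_0}(\gamma_t,w)=\{\varphi\in C^1(\Lambda^t):0=(w-\varphi)(\gamma_t)=\sup_{\eta_s\in\mathcal C^\mu_{t,M_0}}(w-\varphi)(\eta_s)\}$ and $J^-_{\mu,M_0}(\gamma_t,w)=\{\varphi\in C^1(\Lambda^t):0=(w+\varphi)(\gamma_t)=\inf_{\eta_s\in\mathcal C^\mu_{t,M_0}}(w+\varphi)(\eta_s)\}$. $w\in C^0(\Lambda)$ is a viscosity $\mu$-subsolution (resp. $\mu$-supersolution) if $w(\gamma_T)\le\phi(\gamma_T)$ (resp. $\ge$) for all $\gamma_T\in\Lambda_T$ and, for every $M_0>0$, whenever $\varphi\in J^+_{\mu,M_0}(\gamma_s,w)$ (resp. $J^-_{\mu,M_0}(\gamma_s,w)$) with $s\in[0,T)$, $\gamma_s\in\mathcal C^\mu_{M_0}$, $|\gamma_s(s)|<M_0$, one has $\partial_t\varphi(\gamma_s)+\mathbf H(\gamma_s,\partial_x\varphi(\gamma_s))\ge0$ (resp. $-\partial_t\varphi(\gamma_s)+\mathbf H(\gamma_s,-\partial_x\varphi(\gamma_s))\le0$). $w$ is a viscosity subsolution (supersolution) if there is $\mu_0>0$ such that $w$ is a viscosity $\mu$-subsolution ($\mu$-supersolution) for all $\mu\ge\mu_0$; a viscosity solution is both.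
   Formalization: Besides (H), F and q are assumed continuous in the path uniformly in u∈U (automatic for compact U); under (H) alone the claim fails, e.g. T=d=1, U=R, F=φ=0, q(γ_t,u)=cos(ut), where V=t−1 is not a supersolution at t=0. *)

theory Defs
  imports "HOL-Analysis.Analysis"
begin

section \<open>Paths\<close>

text \<open>
  A path on \<open>[0,t]\<close> is a pair \<open>(t, \<gamma>)\<close> of its final time and a function that is
  \<open>extensional\<close> on \<open>{0..t}\<close> (fixed to \<open>undefined\<close> outside), so that
  equality of pairs is equality of functions on \<open>[0,t]\<close>.
\<close>

type_synonym 'd path = "real \<times> (real \<Rightarrow> real^'d)"

definition cadlag_at :: "real \<Rightarrow> ('d::finite) path set" where
  "cadlag_at t = {(t, \<gamma>) | \<gamma>. \<gamma> \<in> extensional {0..t}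
      \<and> (\<forall>s\<in>{0..<t}. (\<gamma> \<longlongrightarrow> \<gamma> s) (at_right s))
      \<and> (\<forall>s\<in>{0<..t}. \<exists>l. (\<gamma> \<longlongrightarrow> l) (at_left s))}"

definition cont_at :: "real \<Rightarrow> ('d::finite) path set" where
  "cont_at t = {(t, \<gamma>) | \<gamma>. \<gamma> \<in> extensional {0..t} \<and> continuous_on {0..t} \<gamma>}"

definition cadlag_from :: "real \<Rightarrow> real \<Rightarrow> ('d::finite) path set" where
  "cadlag_from T t = (\<Union>s\<in>{t..T}. cadlag_at s)"

definition cont_from :: "real \<Rightarrow> real \<Rightarrow> ('d::finite) path set" where
  "cont_from T t = (\<Union>s\<in>{t..T}. cont_at s)"

text \<open>\<open>path_upto X s\<close> is \<open>X\<close> restricted to \<open>[0,s]\<close>; \<open>freeze p s\<close> extends \<open>p\<close> to \<open>[0,s]\<close>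
  by its final value; \<open>bump p x\<close> shifts the final value of \<open>p\<close> by \<open>x\<close>.\<close>

definition path_upto :: "(real \<Rightarrow> real^'d) \<Rightarrow> real \<Rightarrow> ('d::finite) path" where
  "path_upto X s = (s, restrict X {0..s})"

definition freeze :: "('d::finite) path \<Rightarrow> real \<Rightarrow> 'd path" where
  "freeze p s = path_upto (\<lambda>r. snd p (min r (fst p))) s"

definition bump :: "('d::finite) path \<Rightarrow> real^'d \<Rightarrow> 'd path" where
  "bump p x = (fst p, (snd p)(fst p := snd p (fst p) + x))"

definition sup_norm :: "('d::finite) path \<Rightarrow> real" where
  "sup_norm p = (SUP s\<in>{0..fst p}. norm (snd p s))"

text \<open>Freezing the longer of the two paths at its own final time changes nothing, so only the
  shorter one is really extended.\<close>

definition d_inf :: "('d::finite) path \<Rightarrow> 'd path \<Rightarrow> real" where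
  "d_inf p q = (let m = max (fst p) (fst q) in
      \<bar>fst p - fst q\<bar> + (SUP r\<in>{0..m}. norm (snd (freeze p m) r - snd (freeze q m) r)))"

definition d_inf_continuous_on ::
    "('d::finite) path set \<Rightarrow> ('d path \<Rightarrow> real) \<Rightarrow> bool" where
  "d_inf_continuous_on S f \<longleftrightarrow>
     (\<forall>p\<in>S. \<forall>e>0. \<exists>\<delta>>0. \<forall>q\<in>S. d_inf p q < \<delta> \<longrightarrow> \<bar>f q - f p\<bar> < e)"

section \<open>Horizontal and vertical derivatives\<close>

definition has_horizontal_deriv ::
    "(('d::finite) path \<Rightarrow> real) \<Rightarrow> 'd path \<Rightarrow> real \<Rightarrow> bool" where
  "has_horizontal_deriv f p D \<longleftrightarrow>
     ((\<lambda>h. (f (freeze p (fst p + h)) - f p) / h) \<longlongrightarrow> D) (at_right 0)"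

text \<open>At the final time \<open>T\<close>, where paths cannot be extended, the time derivative is the limit of
  the time derivatives along the restrictions to \<open>[0,s]\<close>, \<open>s < T\<close>.\<close>

definition has_time_deriv ::
    "real \<Rightarrow> (('d::finite) path \<Rightarrow> real) \<Rightarrow> 'd path \<Rightarrow> real \<Rightarrow> bool" where
  "has_time_deriv T f p D \<longleftrightarrow>
     (if fst p < T then has_horizontal_deriv f p D
      else ((\<lambda>s. THE E. has_horizontal_deriv f (path_upto (snd p) s) E) \<longlongrightarrow> D) (at_left T))"

definition has_space_deriv ::
    "(('d::finite) path \<Rightarrow> real) \<Rightarrow> 'd \<Rightarrow> 'd path \<Rightarrow> real \<Rightarrow> bool" where
  "has_space_deriv f i p D \<longleftrightarrow>
     ((\<lambda>h. (f (bump p (h *\<^sub>R axis i 1)) - f p) / h) \<longlongrightarrow> D) (at 0)"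

definition time_deriv :: "real \<Rightarrow> (('d::finite) path \<Rightarrow> real) \<Rightarrow> 'd path \<Rightarrow> real" where
  "time_deriv T f p = (THE D. has_time_deriv T f p D)"

definition space_deriv :: "(('d::finite) path \<Rightarrow> real) \<Rightarrow> 'd \<Rightarrow> 'd path \<Rightarrow> real" where
  "space_deriv f i p = (THE D. has_space_deriv f i p D)"

definition space_grad :: "(('d::finite) path \<Rightarrow> real) \<Rightarrow> 'd path \<Rightarrow> real^'d" where
  "space_grad f p = (\<chi> i. space_deriv f i p)"

definition C1_cadlag :: "real \<Rightarrow> real \<Rightarrow> (('d::finite) path \<Rightarrow> real) set" where
  "C1_cadlag T t = {f. d_inf_continuous_on (cadlag_from T t) f
      \<and> (\<forall>p\<in>cadlag_from T t. \<exists>D. has_time_deriv T f p D)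
      \<and> (\<forall>i. \<forall>p\<in>cadlag_from T t. \<exists>D. has_space_deriv f i p D)
      \<and> d_inf_continuous_on (cadlag_from T t) (time_deriv T f)
      \<and> (\<forall>i. d_inf_continuous_on (cadlag_from T t) (space_deriv f i))}"

definition C1_extensions ::
    "real \<Rightarrow> real \<Rightarrow> (('d::finite) path \<Rightarrow> real) \<Rightarrow> ('d path \<Rightarrow> real) set" where
  "C1_extensions T t f = {g \<in> C1_cadlag T t. \<forall>p\<in>cont_from T t. g p = f p}"

definition C1_cont :: "real \<Rightarrow> real \<Rightarrow> (('d::finite) path \<Rightarrow> real) set" where
  "C1_cont T t = {f. C1_extensions T t f \<noteq> {}}"

section \<open>The control problem\<close>

definition controls :: "real \<Rightarrow> real \<Rightarrow> (real \<Rightarrow> 'u::metric_space) set" where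
  "controls T t = measurable (lebesgue_on {t..T}) borel"

definition jointly_continuous ::
    "real \<Rightarrow> (('d::finite) path \<Rightarrow> 'u::metric_space \<Rightarrow> 'b::metric_space) \<Rightarrow> bool" where
  "jointly_continuous T G \<longleftrightarrow>
     (\<forall>p\<in>cont_from T 0. \<forall>u. \<forall>e>0. \<exists>\<delta>>0. \<forall>p'\<in>cont_from T 0. \<forall>u'.
        d_inf p p' < \<delta> \<and> dist u u' < \<delta> \<longrightarrow> dist (G p' u') (G p u) < e)"

definition hypothesis_H ::
    "real \<Rightarrow> (('d::finite) path \<Rightarrow> 'u::metric_space \<Rightarrow> real^'d) \<Rightarrow> ('d path \<Rightarrow> 'u \<Rightarrow> real)
      \<Rightarrow> ('d path \<Rightarrow> real) \<Rightarrow> bool" where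
  "hypothesis_H T F q \<phi> \<longleftrightarrow>
     jointly_continuous T F \<and> jointly_continuous T q \<and> d_inf_continuous_on (cont_at T) \<phi>
     \<and> (\<exists>L>0.
          (\<forall>t\<in>{0..T}. \<forall>p\<in>cont_at t. \<forall>p'\<in>cont_at t. \<forall>u.
             max (norm (F p u - F p' u)) \<bar>q p u - q p' u\<bar> \<le> L * sup_norm (t, \<lambda>r. snd p r - snd p' r))
        \<and> (\<forall>t\<in>{0..T}. \<forall>p\<in>cont_at t. \<forall>u.
             max (norm (F p u)) \<bar>q p u\<bar> \<le> L * (1 + sup_norm p))
        \<and> (\<forall>p\<in>cont_at T. \<forall>p'\<in>cont_at T.
             \<bar>\<phi> p - \<phi> p'\<bar> \<le> L * sup_norm (T, \<lambda>r. snd p r - snd p' r))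
        \<and> (\<forall>p\<in>cont_at T. \<bar>\<phi> p\<bar> \<le> L * (1 + sup_norm p)))"

text \<open>
  Continuity in the path, uniformly in the control. Joint continuity does not imply this when the
  space of controls is not compact, and the Lipschitz estimate above, which is uniform in the
  control, only compares paths with the same final time. Without it the Hamiltonian may be
  discontinuous in time and the value functional need not be a supersolution: take
  \<open>F = 0\<close>, \<open>\<phi> = 0\<close>, \<open>q (t, \<gamma>) u = cos (u * t)\<close> with real controls \<open>u\<close>. Then the
  value functional is \<open>V (t, \<gamma>) = t - T\<close>, whose time derivative is \<open>1\<close>, but at time \<open>0\<close>
  the Hamiltonian is \<open>1\<close>.
\<close>

definition continuous_uniformly_in_control ::
    "real \<Rightarrow> (('d::finite) path \<Rightarrow> 'u \<Rightarrow> 'b::metric_space) \<Rightarrow> bool" where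
  "continuous_uniformly_in_control T G \<longleftrightarrow>
     (\<forall>p\<in>cont_from T 0. \<forall>e>0. \<exists>\<delta>>0. \<forall>p'\<in>cont_from T 0.
        d_inf p p' < \<delta> \<longrightarrow> (\<forall>u. dist (G p' u) (G p u) < e))"

definition is_trajectory ::
    "real \<Rightarrow> (('d::finite) path \<Rightarrow> 'u \<Rightarrow> real^'d) \<Rightarrow> 'd path \<Rightarrow> (real \<Rightarrow> 'u)
      \<Rightarrow> (real \<Rightarrow> real^'d) \<Rightarrow> bool" where
  "is_trajectory T F p u X \<longleftrightarrow>
     X \<in> extensional {0..T} \<and> continuous_on {0..T} X
     \<and> (\<forall>s\<in>{0..fst p}. X s = snd p s)
     \<and> (\<forall>s\<in>{fst p..T}.
          set_integrable lebesgue {fst p..s} (\<lambda>\<sigma>. F (path_upto X \<sigma>) (u \<sigma>))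
          \<and> X s = snd p (fst p) + (LINT \<sigma>:{fst p..s}|lebesgue. F (path_upto X \<sigma>) (u \<sigma>)))"

definition trajectory ::
    "real \<Rightarrow> (('d::finite) path \<Rightarrow> 'u \<Rightarrow> real^'d) \<Rightarrow> 'd path \<Rightarrow> (real \<Rightarrow> 'u)
      \<Rightarrow> real \<Rightarrow> real^'d" where
  "trajectory T F p u = (THE X. is_trajectory T F p u X)"

definition cost ::
    "real \<Rightarrow> (('d::finite) path \<Rightarrow> 'u \<Rightarrow> real^'d) \<Rightarrow> ('d path \<Rightarrow> 'u \<Rightarrow> real)
      \<Rightarrow> ('d path \<Rightarrow> real) \<Rightarrow> 'd path \<Rightarrow> (real \<Rightarrow> 'u) \<Rightarrow> real" where
  "cost T F q \<phi> p u =
     (LINT \<sigma>:{fst p..T}|lebesgue. q (path_upto (trajectory T F p u) \<sigma>) (u \<sigma>))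
     + \<phi> (path_upto (trajectory T F p u) T)"

definition value_functional ::
    "real \<Rightarrow> (('d::finite) path \<Rightarrow> 'u::metric_space \<Rightarrow> real^'d) \<Rightarrow> ('d path \<Rightarrow> 'u \<Rightarrow> real)
      \<Rightarrow> ('d path \<Rightarrow> real) \<Rightarrow> 'd path \<Rightarrow> real" where
  "value_functional T F q \<phi> p = (INF u\<in>controls T (fst p). cost T F q \<phi> p u)"

definition hamiltonian ::
    "(('d::finite) path \<Rightarrow> 'u \<Rightarrow> real^'d) \<Rightarrow> ('d path \<Rightarrow> 'u \<Rightarrow> real)
      \<Rightarrow> 'd path \<Rightarrow> real^'d \<Rightarrow> real" where
  "hamiltonian F q p z = (INF u. z \<bullet> F p u + q p u)"

section \<open>Viscosity solutions\<close>

definition lip_paths :: "real \<Rightarrow> real \<Rightarrow> real \<Rightarrow> real \<Rightarrow> ('d::finite) path set" where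
  "lip_paths T t \<mu> M = {p \<in> cont_from T t. sup_norm p \<le> M
      \<and> (\<forall>l r. 0 \<le> l \<and> l < r \<and> r \<le> fst p
           \<longrightarrow> norm (snd p l - snd p r) / \<bar>l - r\<bar> \<le> \<mu> * (1 + M))}"

text \<open>Suprema and infima are taken in the extended reals, where they always exist.\<close>

definition J_plus ::
    "real \<Rightarrow> real \<Rightarrow> real \<Rightarrow> ('d::finite) path \<Rightarrow> ('d path \<Rightarrow> real) \<Rightarrow> ('d path \<Rightarrow> real) set" where
  "J_plus T \<mu> M p w = {\<psi> \<in> C1_cont T (fst p). w p - \<psi> p = 0
      \<and> (SUP \<eta>\<in>lip_paths T (fst p) \<mu> M. ereal (w \<eta> - \<psi> \<eta>)) = 0}"

definition J_minus ::
    "real \<Rightarrow> real \<Rightarrow> real \<Rightarrow> ('d::finite) path \<Rightarrow> ('d path \<Rightarrow> real) \<Rightarrow> ('d path \<Rightarrow> real) set" where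
  "J_minus T \<mu> M p w = {\<psi> \<in> C1_cont T (fst p). w p + \<psi> p = 0
      \<and> (INF \<eta>\<in>lip_paths T (fst p) \<mu> M. ereal (w \<eta> + \<psi> \<eta>)) = 0}"

text \<open>
  The derivatives of \<open>\<psi>\<close> on continuous paths are those of an extension of \<open>\<psi>\<close> to cadlag paths.
  They do not depend on the extension; the inequalities below are required for every extension.
  Below, \<open>H\<close> is the Hamiltonian and \<open>\<phi>\<close> the terminal datum.
\<close>

definition viscosity_mu_subsolution ::
    "real \<Rightarrow> (('d::finite) path \<Rightarrow> real^'d \<Rightarrow> real) \<Rightarrow> ('d path \<Rightarrow> real) \<Rightarrow> real
      \<Rightarrow> ('d path \<Rightarrow> real) \<Rightarrow> bool" where
  "viscosity_mu_subsolution T H \<phi> \<mu> w \<longleftrightarrow>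
     d_inf_continuous_on (cont_from T 0) w
     \<and> (\<forall>p\<in>cont_at T. w p \<le> \<phi> p)
     \<and> (\<forall>M>0. \<forall>p\<in>lip_paths T 0 \<mu> M. fst p < T \<longrightarrow> norm (snd p (fst p)) < M \<longrightarrow>
          (\<forall>\<psi>\<in>J_plus T \<mu> M p w. \<forall>g\<in>C1_extensions T (fst p) \<psi>.
             time_deriv T g p + H p (space_grad g p) \<ge> 0))"

definition viscosity_mu_supersolution ::
    "real \<Rightarrow> (('d::finite) path \<Rightarrow> real^'d \<Rightarrow> real) \<Rightarrow> ('d path \<Rightarrow> real) \<Rightarrow> real
      \<Rightarrow> ('d path \<Rightarrow> real) \<Rightarrow> bool" where
  "viscosity_mu_supersolution T H \<phi> \<mu> w \<longleftrightarrow>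
     d_inf_continuous_on (cont_from T 0) w
     \<and> (\<forall>p\<in>cont_at T. w p \<ge> \<phi> p)
     \<and> (\<forall>M>0. \<forall>p\<in>lip_paths T 0 \<mu> M. fst p < T \<longrightarrow> norm (snd p (fst p)) < M \<longrightarrow>
          (\<forall>\<psi>\<in>J_minus T \<mu> M p w. \<forall>g\<in>C1_extensions T (fst p) \<psi>.
             - time_deriv T g p + H p (- space_grad g p) \<le> 0))"

definition viscosity_solution ::
    "real \<Rightarrow> (('d::finite) path \<Rightarrow> real^'d \<Rightarrow> real) \<Rightarrow> ('d path \<Rightarrow> real)
      \<Rightarrow> ('d path \<Rightarrow> real) \<Rightarrow> bool" where
  "viscosity_solution T H \<phi> w \<longleftrightarrow>
     (\<exists>\<mu>\<^sub>0>0. \<forall>\<mu>\<ge>\<mu>\<^sub>0. viscosity_mu_subsolution T H \<phi> \<mu> w)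
     \<and> (\<exists>\<mu>\<^sub>0>0. \<forall>\<mu>\<ge>\<mu>\<^sub>0. viscosity_mu_supersolution T H \<phi> \<mu> w)"

end

theory Submission
  imports Defs
begin

text \<open>
  The Lipschitz class of paths in the definition of viscosity solutions is invariant under the
  controlled dynamics as soon as \<open>\<mu>\<close> dominates the growth constant \<open>L\<close>, so trajectories started at
  the contact point are admissible competitors for the test functional. Dynamic programming along
  them, combined with a first-order expansion of the test functional that is uniform over all
  trajectories with a common Lipschitz constant, gives both viscosity inequalities after division
  by the length of the time step. Constant controls suffice for the subsolution property, nearly
  optimal ones are used for the supersolution property; uniformity in the control is what allows
  the latter to depend on the time step.
\<close>

section \<open>Paths\<close>

text \<open>A trajectory is neither frozen nor does it jump at its end, so the two derivatives of a
  test functional say nothing about it directly, and its velocity is only measurable in time, so no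
  classical chain rule applies along it. The expansion is therefore proved for step paths, which are
  then sent to the trajectory with the time step \<open>h\<close> fixed; the limit uses continuity
  of the functional, and the error stays of order \<open>e * h\<close> whatever the number of steps.
  The order of choices matters: a control that is optimal up to \<open>e * h\<close> can be picked
  only after \<open>h\<close>. Hence \<open>h\<close> comes from bounds shared by all controls: an a
  priori bound on trajectories gives a common speed, and the strict inequality for the end value at
  the contact point leaves room to stay below \<open>M\<close> for a short time. Below
  \<open>M\<close>, linear growth limits the speed to \<open>L * (1 + M)\<close>, which is where the
  threshold for \<open>\<mu>\<close> comes from. The weight \<open>exp (2 * L * r)\<close> behind
  existence, uniqueness and the bounds of trajectories is chosen so that integrating a Lipschitz
  estimate against it gains a factor 1/2.\<close>

lemma path_upto_simps [simp]:
  "fst (path_upto X s) = s" "r \<in> {0..s} \<Longrightarrow> snd (path_upto X s) r = X r"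
  by (auto simp: path_upto_def)

lemma path_upto_cont_at:
  assumes "continuous_on {0..T} X" "s \<le> T"
  shows "path_upto X s \<in> cont_at s"
proof -
  have "continuous_on {0..s} X"
    using assms by (auto intro: continuous_on_subset)
  then have "continuous_on {0..s} (restrict X {0..s})"
    by (rule continuous_on_eq) auto
  then show ?thesis
    by (auto simp: path_upto_def cont_at_def)
qed

lemma path_upto_cont_from:
  assumes "continuous_on {0..T} X" "t \<le> s" "s \<le> T"
  shows "path_upto X s \<in> cont_from T t"
  using path_upto_cont_at[OF assms(1,3)] assms by (auto simp: cont_from_def)

lemma cont_atD:
  assumes "p \<in> cont_at t"
  shows "fst p = t" "snd p \<in> extensional {0..t}" "continuous_on {0..t} (snd p)"
  using assms by (auto simp: cont_at_def)

lemma cont_fromD: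
  assumes "p \<in> cont_from T t"
  shows "t \<le> fst p" "fst p \<le> T" "p \<in> cont_at (fst p)"
    "snd p \<in> extensional {0..fst p}" "continuous_on {0..fst p} (snd p)"
  using assms by (auto simp: cont_from_def cont_at_def)

lemma cont_at_cont_from:
  assumes "p \<in> cont_at s" "t \<le> s" "s \<le> T"
  shows "p \<in> cont_from T t"
  using assms by (auto simp: cont_from_def)

lemma path_upto_eqI:
  assumes "p \<in> cont_at s" "\<And>r. r \<in> {0..s} \<Longrightarrow> X r = snd p r"
  shows "path_upto X s = p"
proof -
  have "restrict X {0..s} = snd p"
    using assms cont_atD(2)[OF assms(1)]
    by (intro extensionalityI[of _ "{0..s}"]) auto
  then show ?thesis
    using cont_atD(1)[OF assms(1)] by (auto simp: path_upto_def prod_eq_iff)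
qed

lemma path_upto_cong:
  assumes "\<And>r. r \<in> {0..s} \<Longrightarrow> X r = Y r"
  shows "path_upto X s = path_upto Y s"
  using assms by (auto simp: path_upto_def restrict_def)

lemma norm_le_sup_norm:
  assumes "continuous_on {0..fst p} (snd p)" "s \<in> {0..fst p}"
  shows "norm (snd p s) \<le> sup_norm p"
  unfolding sup_norm_def
proof (rule cSUP_upper[OF assms(2)])
  have "compact ((\<lambda>s. norm (snd p s)) ` {0..fst p})"
    using assms(1) by (intro compact_continuous_image continuous_on_norm) auto
  then show "bdd_above ((\<lambda>s. norm (snd p s)) ` {0..fst p})"
    by (simp add: bounded_imp_bdd_above compact_imp_bounded)
qed

lemma sup_norm_le:
  assumes "0 \<le> fst p" "\<And>s. s \<in> {0..fst p} \<Longrightarrow> norm (snd p s) \<le> B"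
  shows "sup_norm p \<le> B"
  unfolding sup_norm_def using assms by (intro cSUP_least) auto

lemma sup_norm_path_upto_le:
  assumes "0 \<le> s" "\<And>r. r \<in> {0..s} \<Longrightarrow> norm (X r) \<le> B"
  shows "sup_norm (path_upto X s) \<le> B"
  using assms by (intro sup_norm_le) auto

lemma freeze_simps [simp]:
  "fst (freeze p s) = s" "r \<in> {0..s} \<Longrightarrow> snd (freeze p s) r = snd p (min r (fst p))"
  by (auto simp: freeze_def)

text \<open>An upper bound on a real supremum only needs a nonempty index set, so no regularity of
  the paths is asked for. This makes the estimate available for cadlag step paths.\<close>

lemma d_inf_le:
  assumes "0 \<le> max (fst p) (fst q)"
    and "\<And>r. r \<in> {0..max (fst p) (fst q)} \<Longrightarrow>
      norm (snd p (min r (fst p)) - snd q (min r (fst q))) \<le> B"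
  shows "d_inf p q \<le> \<bar>fst p - fst q\<bar> + B"
proof -
  have "(SUP r\<in>{0..max (fst p) (fst q)}. norm (snd (freeze p (max (fst p) (fst q))) r
      - snd (freeze q (max (fst p) (fst q))) r)) \<le> B"
    using assms by (intro cSUP_least) auto
  then show ?thesis
    by (simp add: d_inf_def Let_def)
qed

lemma d_inf_commute: "d_inf p q = d_inf q p"
  by (simp add: d_inf_def Let_def max.commute norm_minus_commute abs_minus_commute)

text \<open>A real supremum dominates its members only if they are bounded above; continuity of both
  paths on compact intervals provides this.\<close>

lemma d_inf_ge:
  assumes p: "continuous_on {0..fst p} (snd p)" and q: "continuous_on {0..fst q} (snd q)"
    and "0 \<le> fst p" "0 \<le> fst q" "r \<in> {0..max (fst p) (fst q)}"
  shows "\<bar>fst p - fst q\<bar> + norm (snd p (min r (fst p)) - snd q (min r (fst q))) \<le> d_inf p q"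
proof -
  let ?m = "max (fst p) (fst q)"
  let ?D = "\<lambda>r. norm (snd (freeze p ?m) r - snd (freeze q ?m) r)"
  have c1: "continuous_on {0..?m} (\<lambda>r. snd p (min r (fst p)))"
    using assms by (intro continuous_on_compose2[OF p]) (auto intro!: continuous_intros)
  have c2: "continuous_on {0..?m} (\<lambda>r. snd q (min r (fst q)))"
    using assms by (intro continuous_on_compose2[OF q]) (auto intro!: continuous_intros)
  have "continuous_on {0..?m} ?D \<longleftrightarrow>
    continuous_on {0..?m} (\<lambda>r. norm (snd p (min r (fst p)) - snd q (min r (fst q))))"
    by (intro continuous_on_cong) auto
  also have \<dots>
    using c1 c2 by (intro continuous_intros)
  finally have "compact (?D ` {0..?m})"
    by (intro compact_continuous_image) auto
  then have "bdd_above (?D ` {0..?m})"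
    by (simp add: bounded_imp_bdd_above compact_imp_bounded)
  then have "?D r \<le> (SUP r\<in>{0..?m}. ?D r)"
    using assms(5) by (intro cSUP_upper) auto
  then show ?thesis
    using assms(5) by (simp add: d_inf_def Let_def)
qed

lemma d_inf_nonneg:
  assumes "continuous_on {0..fst p} (snd p)" "continuous_on {0..fst q} (snd q)"
    "0 \<le> fst p" "0 \<le> fst q"
  shows "0 \<le> d_inf p q"
proof -
  have "0 \<le> \<bar>fst p - fst q\<bar> + norm (snd p (min 0 (fst p)) - snd q (min 0 (fst q)))"
    by simp
  also have "\<dots> \<le> d_inf p q"
    using assms(3,4) by (intro d_inf_ge[OF assms]) auto
  finally show ?thesis .
qed

lemma d_inf_path_upto_le:
  assumes X: "\<And>r r'. r \<in> {s..s'} \<Longrightarrow> r' \<in> {s..s'} \<Longrightarrow> norm (X r - X r') \<le> B"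
    and "0 \<le> s" "s \<le> s'"
  shows "d_inf (path_upto X s) (path_upto X s') \<le> (s' - s) + B"
proof -
  have "d_inf (path_upto X s) (path_upto X s') \<le> 
      \<bar>fst (path_upto X s) - fst (path_upto X s')\<bar> + B"
  proof (rule d_inf_le)
    fix r assume r: "r \<in> {0..max (fst (path_upto X s)) (fst (path_upto X s'))}"
    have B: "0 \<le> B"
      using X[of s s] assms by auto
    show "norm (snd (path_upto X s) (min r (fst (path_upto X s)))
        - snd (path_upto X s') (min r (fst (path_upto X s')))) \<le> B"
      using r assms B by (cases "r \<le> s") (auto simp: min_def intro!: X)
  qed (use assms in auto)
  then show ?thesis
    using assms by simp
qed

text \<open>The time gap and the oscillation of \<open>X\<close> each use half of \<delta>. One
  \<eta> serves all pairs of times because \<open>X\<close> is uniformly continuous on the compact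
  interval.\<close>

lemma d_inf_path_upto_small:
  assumes X: "continuous_on {0..T} X" and "\<delta> > 0"
  obtains \<eta> where "\<eta> > 0" "\<And>s s'. s \<in> {0..T} \<Longrightarrow> s' \<in> {0..T} \<Longrightarrow> \<bar>s - s'\<bar> < \<eta> \<Longrightarrow>
    d_inf (path_upto X s) (path_upto X s') < \<delta>"
proof -
  have "uniformly_continuous_on {0..T} X"
    using X by (intro compact_uniformly_continuous) auto
  then obtain \<eta> where \<eta>: "\<eta> > 0" "\<And>r r'. r \<in> {0..T} \<Longrightarrow> r' \<in> {0..T} \<Longrightarrow> dist r' r < \<eta> \<Longrightarrow>
      dist (X r') (X r) < \<delta> / 2"
    using \<open>\<delta> > 0\<close> unfolding uniformly_continuous_on_def by (metis half_gt_zero)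
  have *: "d_inf (path_upto X s) (path_upto X s') < \<delta>"
    if "0 \<le> s" "s \<le> s'" "s' \<le> T" "s' - s < min \<eta> (\<delta> / 2)" for s s'
  proof -
    have "d_inf (path_upto X s) (path_upto X s') \<le> (s' - s) + \<delta> / 2"
    proof (rule d_inf_path_upto_le)
      fix r r' assume "r \<in> {s..s'}" "r' \<in> {s..s'}"
      then have "dist (X r) (X r') < \<delta> / 2"
        using that by (intro \<eta>) (auto simp: dist_real_def)
      then show "norm (X r - X r') \<le> \<delta> / 2"
        by (simp add: dist_norm)
    qed (use that in auto)
    then show ?thesis
      using that by auto
  qed
  show ?thesis
  proof (rule that[of "min \<eta> (\<delta> / 2)"])
    show "d_inf (path_upto X s) (path_upto X s') < \<delta>"
      if "s \<in> {0..T}" "s' \<in> {0..T}" "\<bar>s - s'\<bar> < min \<eta> (\<delta> / 2)" for s s'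
      using *[of s s'] *[of s' s] that
      by (cases "s \<le> s'") (auto simp: d_inf_commute[of "path_upto X s'"])
  qed (use \<eta> \<open>\<delta> > 0\<close> in auto)
qed

section \<open>Integrands along paths\<close>

lemma jointly_continuous_control:
  fixes G :: "('d::finite) path \<Rightarrow> 'u::metric_space \<Rightarrow> 'b::metric_space"
  assumes G: "jointly_continuous T G" and p: "p \<in> cont_from T 0"
  shows "continuous_on UNIV (G p)"
  unfolding continuous_on_iff
proof safe
  fix v :: 'u and e :: real assume "e > 0"
  then obtain \<delta> where \<delta>: "\<delta> > 0" "\<And>p' u'. p' \<in> cont_from T 0 \<Longrightarrow> d_inf p p' < \<delta> \<Longrightarrow> dist v u' < \<delta> \<Longrightarrow>
      dist (G p' u') (G p v) < e"
    using G p unfolding jointly_continuous_def by meson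
  have "d_inf p p \<le> \<bar>fst p - fst p\<bar> + 0"
    using cont_fromD(1)[OF p] by (intro d_inf_le) auto
  then show "\<exists>d>0. \<forall>x'\<in>UNIV. dist x' v < d \<longrightarrow> dist (G p x') (G p v) < e"
    using \<delta> p by (intro exI[of _ \<delta>]) (auto simp: dist_commute)
qed

lemma jointly_continuous_along:
  fixes G :: "('d::finite) path \<Rightarrow> 'u::metric_space \<Rightarrow> 'b::metric_space"
  assumes G: "jointly_continuous T G" and X: "continuous_on {0..T} X"
  shows "continuous_on {0..T} (\<lambda>s. G (path_upto X s) v)"
  unfolding continuous_on_iff
proof safe
  fix s e :: real assume s: "s \<in> {0..T}" and "e > 0"
  then obtain \<delta> where \<delta>: "\<delta> > 0" "\<And>p'. p' \<in> cont_from T 0 \<Longrightarrow> d_inf (path_upto X s) p' < \<delta> \<Longrightarrow>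
      dist (G p' v) (G (path_upto X s) v) < e"
    using G path_upto_cont_from[OF X, of 0 s] unfolding jointly_continuous_def
    by (metis atLeastAtMost_iff dist_self)
  obtain \<eta> where \<eta>: "\<eta> > 0" "\<And>s s'. s \<in> {0..T} \<Longrightarrow> s' \<in> {0..T} \<Longrightarrow> \<bar>s - s'\<bar> < \<eta> \<Longrightarrow>
    d_inf (path_upto X s) (path_upto X s') < \<delta>"
    using d_inf_path_upto_small[OF X \<delta>(1)] by blast
  show "\<exists>d>0. \<forall>x'\<in>{0..T}. dist x' s < d \<longrightarrow>
      dist (G (path_upto X x') v) (G (path_upto X s) v) < e"
    using s \<eta> X by (intro exI[of _ \<eta>]) (auto intro!: \<delta> path_upto_cont_from simp: dist_real_def)
qed

text \<open>The space of controls need not be separable, so the pair of time and control need not be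
  measurable into the Borel sets of the product; discretising time avoids this.\<close>

lemma measurable_along:
  fixes G :: "('d::finite) path \<Rightarrow> 'u::metric_space \<Rightarrow> 'b::metric_space"
  assumes G: "jointly_continuous T G" and X: "continuous_on {0..T} X"
    and t: "0 \<le> t" "t \<le> T" and u: "u \<in> controls T t"
  shows "(\<lambda>s. G (path_upto X s) (u s)) \<in> borel_measurable (lebesgue_on {t..T})"
proof -
  \<comment> \<open>Grid points of mesh \<open>1 / Suc n\<close>, clamped to [0,T] so that
    \<open>X\<close> is always stopped at a time where it is continuous up to that point;
    \<open>Suc n\<close> avoids division by zero.\<close>
  define c where "c = (\<lambda>(n::nat) (k::int). max 0 (min T (real_of_int k / real (Suc n))))"
  have u': "u \<in> borel_measurable (lebesgue_on {t..T})"
    using u by (simp add: controls_def)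
  have c: "c n k \<in> {0..T}" for n k
    using t by (auto simp: c_def)
  have m: "(\<lambda>s. G (path_upto X (c n k)) (u s)) \<in> borel_measurable (lebesgue_on {t..T})" for n k
  proof (rule measurable_compose[OF u'])
    have "continuous_on UNIV (G (path_upto X (c n k)))"
      using c[of n k] by (intro jointly_continuous_control[OF G] path_upto_cont_from[OF X]) auto
    then show "G (path_upto X (c n k)) \<in> borel_measurable borel"
      by (rule borel_measurable_continuous_onI)
  qed
  have fl: "(\<lambda>s::real. \<lfloor>s * real (Suc n)\<rfloor>) \<in> measurable (lebesgue_on {t..T}) (count_space UNIV)" for n
  proof -
    have "(\<lambda>s::real. \<lfloor>s * real (Suc n)\<rfloor>) \<in> measurable borel (count_space UNIV)"
      by measurable
    then show ?thesis
      by (intro measurable_restrict_space1 measurable_completion) simp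
  qed
  \<comment> \<open>For a fixed grid time the integrand is a continuous function of the measurable
    control; the countably many grid times are then glued together.\<close>
  have "(\<lambda>s. G (path_upto X (c n \<lfloor>s * real (Suc n)\<rfloor>)) (u s)) \<in> borel_measurable (lebesgue_on {t..T})" for n
    using measurable_compose_countable[OF m[of n] fl[of n]] by simp
  then show ?thesis
  proof (rule borel_measurable_LIMSEQ_metric)
    fix s assume "s \<in> space (lebesgue_on {t..T})"
    then have s: "s \<in> {0..T}"
      using t by (auto simp: space_restrict_space)
    have "(\<lambda>n. c n \<lfloor>s * real (Suc n)\<rfloor>) \<longlonglongrightarrow> s"
    proof (rule LIMSEQ_I)
      fix e :: real assume "e > 0"
      then obtain N where N: "inverse (real (Suc N)) < e"
        using reals_Archimedean by blast
      show "\<exists>no. \<forall>n\<ge>no. norm (c n \<lfloor>s * real (Suc n)\<rfloor> - s) < e"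
      proof (intro exI[of _ N] allI impI)
        fix n assume "n \<ge> N"
        define y where "y = real_of_int \<lfloor>s * real (Suc n)\<rfloor> / real (Suc n)"
        have "real_of_int \<lfloor>s * real (Suc n)\<rfloor> \<le> s * real (Suc n)"
          "s * real (Suc n) < real_of_int \<lfloor>s * real (Suc n)\<rfloor> + 1"
          by linarith+
        then have "y \<le> s" "s < y + inverse (real (Suc n))"
          unfolding y_def by (simp_all add: field_simps)
        moreover have "inverse (real (Suc n)) \<le> inverse (real (Suc N))"
          using \<open>n \<ge> N\<close> by simp
        ultimately have "\<bar>y - s\<bar> < e"
          using N by linarith
        then show "norm (c n \<lfloor>s * real (Suc n)\<rfloor> - s) < e"
          using s unfolding c_def y_def[symmetric] by (auto simp: max_def min_def)
      qed
    qed
    then show "(\<lambda>n. G (path_upto X (c n \<lfloor>s * real (Suc n)\<rfloor>)) (u s)) \<longlonglongrightarrow> G (path_upto X s) (u s)"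
      using c s by (intro continuous_on_tendsto_compose[OF jointly_continuous_along[OF G X]]) auto
  qed
qed

text \<open>The part of hypothesis (H) shared by the vector-valued \<open>F\<close> and the
  real-valued \<open>q\<close>, so that each estimate is proved once for both.\<close>

definition lipschitz_integrand ::
    "real \<Rightarrow> real \<Rightarrow> (('d::finite) path \<Rightarrow> 'u::metric_space \<Rightarrow> 'b::euclidean_space) \<Rightarrow> bool" where
  "lipschitz_integrand T L G \<longleftrightarrow> jointly_continuous T G
     \<and> (\<forall>t\<in>{0..T}. \<forall>p\<in>cont_at t. \<forall>p'\<in>cont_at t. \<forall>u.
          norm (G p u - G p' u) \<le> L * sup_norm (t, \<lambda>r. snd p r - snd p' r))
     \<and> (\<forall>t\<in>{0..T}. \<forall>p\<in>cont_at t. \<forall>u. norm (G p u) \<le> L * (1 + sup_norm p))"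

lemma lipschitz_integrand_diff:
  assumes G: "lipschitz_integrand T L G" and "0 \<le> L"
    and X: "continuous_on {0..T} X" "continuous_on {0..T} X'" and s: "s \<in> {0..T}"
    and B: "\<And>r. r \<in> {0..s} \<Longrightarrow> norm (X r - X' r) \<le> B"
  shows "norm (G (path_upto X s) v - G (path_upto X' s) v) \<le> L * B"
proof -
  have "norm (G (path_upto X s) v - G (path_upto X' s) v)
      \<le> L * sup_norm (s, \<lambda>r. snd (path_upto X s) r - snd (path_upto X' s) r)"
    using G s path_upto_cont_at[OF X(1), of s] path_upto_cont_at[OF X(2), of s]
    unfolding lipschitz_integrand_def by auto
  also have "\<dots> \<le> L * B"
    using s B \<open>0 \<le> L\<close> by (intro mult_left_mono sup_norm_le) auto
  finally show ?thesis .
qed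

lemma lipschitz_integrand_growth:
  assumes G: "lipschitz_integrand T L G" and "0 \<le> L"
    and X: "continuous_on {0..T} X" and s: "s \<in> {0..T}"
    and B: "\<And>r. r \<in> {0..s} \<Longrightarrow> norm (X r) \<le> B"
  shows "norm (G (path_upto X s) v) \<le> L * (1 + B)"
proof -
  have "norm (G (path_upto X s) v) \<le> L * (1 + sup_norm (path_upto X s))"
    using G s path_upto_cont_at[OF X, of s] unfolding lipschitz_integrand_def by auto
  also have "\<dots> \<le> L * (1 + B)"
    using s B \<open>0 \<le> L\<close> by (intro mult_left_mono add_left_mono sup_norm_path_upto_le) auto
  finally show ?thesis .
qed

text \<open>The integrand is measurable, and it is bounded: the range of \<open>X\<close> is compact
  and growth in the path is linear, uniformly in the control.\<close>

lemma lipschitz_integrand_integrable: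
  assumes G: "lipschitz_integrand T L G" and "0 \<le> L"
    and X: "continuous_on {0..T} X" and t: "0 \<le> t" "t \<le> T" and u: "u \<in> controls T t"
    and ab: "t \<le> a" "b \<le> T"
  shows "(\<lambda>s. G (path_upto X s) (u s)) absolutely_integrable_on {a..b}"
    and "(\<lambda>s. G (path_upto X s) (u s)) integrable_on {a..b}"
proof -
  have "compact (X ` {0..T})"
    using X by (intro compact_continuous_image) auto
  then obtain B where B: "\<And>r. r \<in> {0..T} \<Longrightarrow> norm (X r) \<le> B"
    by (meson bounded_iff compact_imp_bounded image_eqI)
  have "(\<lambda>s. G (path_upto X s) (u s)) absolutely_integrable_on {t..T}"
  proof (rule measurable_bounded_by_integrable_imp_absolutely_integrable)
    show "(\<lambda>s. G (path_upto X s) (u s)) \<in> borel_measurable (lebesgue_on {t..T})"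
      using G unfolding lipschitz_integrand_def by (intro measurable_along X t u) auto
    show "norm (G (path_upto X s) (u s)) \<le> L * (1 + B)" if "s \<in> {t..T}" for s
      using that t B by (intro lipschitz_integrand_growth[OF G \<open>0 \<le> L\<close> X]) auto
  qed auto
  then show *: "(\<lambda>s. G (path_upto X s) (u s)) absolutely_integrable_on {a..b}"
    by (rule absolutely_integrable_on_subinterval) (use ab in auto)
  then show "(\<lambda>s. G (path_upto X s) (u s)) integrable_on {a..b}"
    by (rule set_lebesgue_integral_eq_integral)
qed

text \<open>Let \<open>W\<close> be the maximum of \<open>m r * exp (- (2 * L * r))\<close>,
  attained at \<open>x\<close> by continuity. The hypothesis \<open>step\<close> at \<open>x\<close>
  gives \<open>W * exp (2 * L * x) \<le> a + W / 2 * exp (2 * L * x)\<close>, hence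
  \<open>W \<le> 2 * a\<close>. The form of \<open>step\<close> matches what an integral equation
  with Lipschitz right-hand side delivers.\<close>

lemma weighted_gronwall:
  fixes m :: "real \<Rightarrow> real"
  assumes m: "continuous_on {0..T} m" "\<And>r. r \<in> {0..T} \<Longrightarrow> 0 \<le> m r" and "0 \<le> L" "0 \<le> a"
    and step: "\<And>W s. 0 \<le> W \<Longrightarrow> (\<And>r. r \<in> {0..T} \<Longrightarrow> m r \<le> W * exp (2 * L * r)) \<Longrightarrow> s \<in> {0..T} \<Longrightarrow>
      m s \<le> a + W / 2 * exp (2 * L * s)"
    and s: "s \<in> {0..T}"
  shows "m s \<le> 2 * a * exp (2 * L * s)"
proof -
  obtain x where x: "x \<in> {0..T}"
    and max: "\<And>r. r \<in> {0..T} \<Longrightarrow> m r * exp (- (2 * L * r)) \<le> m x * exp (- (2 * L * x))"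
    using continuous_attains_sup[of "{0..T}" "\<lambda>r. m r * exp (- (2 * L * r))"] s m(1)
    by (force intro!: continuous_intros)
  define W where "W = m x * exp (- (2 * L * x))"
  have W: "m r \<le> W * exp (2 * L * r)" if "r \<in> {0..T}" for r
  proof -
    have "m r = m r * exp (- (2 * L * r)) * exp (2 * L * r)"
      by (simp add: exp_minus)
    also have "\<dots> \<le> W * exp (2 * L * r)"
      unfolding W_def using max[OF that] by (intro mult_right_mono) auto
    finally show ?thesis .
  qed
  have "0 \<le> W"
    using m(2)[OF x] by (simp add: W_def)
  have "W * exp (2 * L * x) = m x"
    by (simp add: W_def exp_minus)
  also have "\<dots> \<le> a + W / 2 * exp (2 * L * x)"
    using \<open>0 \<le> W\<close> W x by (rule step)
  finally have "W / 2 * exp (2 * L * x) \<le> a"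
    by simp
  moreover have "W / 2 * 1 \<le> W / 2 * exp (2 * L * x)"
    using \<open>0 \<le> W\<close> \<open>0 \<le> L\<close> x by (intro mult_left_mono) auto
  ultimately have "W \<le> 2 * a"
    by simp
  then have "W * exp (2 * L * s) \<le> 2 * a * exp (2 * L * s)"
    by (intro mult_right_mono) auto
  then show ?thesis
    using W[OF s] by (rule order_trans[rotated])
qed

text \<open>The exponent has rate \<open>2 * L\<close> while the integrand carries the factor
  \<open>L\<close>, so integration leaves \<open>W / 2\<close>. This half is both the contraction
  constant of the Picard map and the gain required by \<open>weighted_gronwall\<close>.\<close>

lemma norm_integral_exp_le:
  fixes f :: "real \<Rightarrow> 'a::euclidean_space"
  assumes f: "f integrable_on {t..s}" and "t \<le> s" "0 < L" "0 \<le> W"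
    and le: "\<And>r. r \<in> {t..s} \<Longrightarrow> norm (f r) \<le> L * (W * exp (2 * L * r))"
  shows "norm (integral {t..s} f) \<le> W / 2 * exp (2 * L * s)"
proof -
  have *: "((\<lambda>r. L * (W * exp (2 * L * r))) has_integral
      (W / 2 * exp (2 * L * s) - W / 2 * exp (2 * L * t))) {t..s}"
    using \<open>t \<le> s\<close> \<open>0 < L\<close>
    by (intro fundamental_theorem_of_calculus)
       (auto simp flip: has_real_derivative_iff_has_vector_derivative intro!: derivative_eq_intros)
  have "norm (integral {t..s} f) \<le> integral {t..s} (\<lambda>r. L * (W * exp (2 * L * r)))"
    using * by (intro integral_norm_bound_integral f le) auto
  also have "\<dots> = W / 2 * exp (2 * L * s) - W / 2 * exp (2 * L * t)"
    using * by (rule integral_unique)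
  also have "\<dots> \<le> W / 2 * exp (2 * L * s)"
    using \<open>0 \<le> W\<close> by simp
  finally show ?thesis .
qed

lemma norm_integral_le_const:
  fixes f :: "real \<Rightarrow> 'a::euclidean_space"
  assumes f: "f integrable_on {t..s}" and "t \<le> s"
    and le: "\<And>r. r \<in> {t..s} \<Longrightarrow> norm (f r) \<le> K"
  shows "norm (integral {t..s} f) \<le> K * (s - t)"
proof -
  have "norm (integral {t..s} f) \<le> integral {t..s} (\<lambda>r. K)"
    by (intro integral_norm_bound_integral f le) auto
  then show ?thesis
    using \<open>t \<le> s\<close> by (simp add: mult.commute)
qed

section \<open>Trajectories\<close>

text \<open>Hypothesis (H) with its constant \<open>L\<close> made explicit, since \<open>L\<close>
  enters all bounds and also the threshold for \<open>\<mu>\<close>.\<close>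

locale control_problem =
  fixes T L :: real
    and F :: "('d::finite) path \<Rightarrow> 'u::metric_space \<Rightarrow> real^'d"
    and q :: "'d path \<Rightarrow> 'u \<Rightarrow> real"
    and \<phi> :: "'d path \<Rightarrow> real"
  assumes T_pos: "0 < T" and L_pos: "0 < L"
    and F: "lipschitz_integrand T L F" and q: "lipschitz_integrand T L q"
    and phi_lipschitz: "\<And>p p'. p \<in> cont_at T \<Longrightarrow> p' \<in> cont_at T \<Longrightarrow>
      \<bar>\<phi> p - \<phi> p'\<bar> \<le> L * sup_norm (T, \<lambda>r. snd p r - snd p' r)"
    and phi_growth: "\<And>p. p \<in> cont_at T \<Longrightarrow> \<bar>\<phi> p\<bar> \<le> L * (1 + sup_norm p)"
begin

lemma L_nonneg: "0 \<le> L"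
  using L_pos by simp

lemma is_trajectory_iff:
  assumes p: "p \<in> cont_from T 0" and u: "u \<in> controls T (fst p)"
  shows "is_trajectory T F p u X \<longleftrightarrow> X \<in> extensional {0..T} \<and> continuous_on {0..T} X
     \<and> (\<forall>s\<in>{0..fst p}. X s = snd p s)
     \<and> (\<forall>s\<in>{fst p..T}. X s = snd p (fst p) + integral {fst p..s} (\<lambda>\<sigma>. F (path_upto X \<sigma>) (u \<sigma>)))"
proof -
  have "(\<lambda>\<sigma>. F (path_upto X \<sigma>) (u \<sigma>)) absolutely_integrable_on {fst p..s}"
    if "continuous_on {0..T} X" "s \<in> {fst p..T}" for s
    using that cont_fromD[OF p] by (intro lipschitz_integrand_integrable[OF F L_nonneg _ _ _ u]) auto
  then show ?thesis
    unfolding is_trajectory_def by (auto simp: set_lebesgue_integral_eq_integral(2))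
qed

text \<open>Banach's fixed point theorem in the complete space of bounded continuous functions on
  the real line. An element \<open>Z\<close> stands for the path \<open>E Z\<close>, which is
  \<open>Z\<close> times the exponential weight, so the supremum distance of the elements is a
  weighted distance of the paths.\<close>

lemma trajectory_exists:
  assumes p: "p \<in> cont_from T 0" and u: "u \<in> controls T (fst p)"
  shows "\<exists>X. is_trajectory T F p u X"
proof -
  define t where "t = fst p"
  define \<gamma> where "\<gamma> = snd p"
  have t: "0 \<le> t" "t \<le> T" and \<gamma>: "continuous_on {0..t} \<gamma>"
    using cont_fromD[OF p] by (auto simp: t_def \<gamma>_def)
  have u': "u \<in> controls T t"
    using u by (simp add: t_def)
  \<comment> \<open>The weight makes the Picard map a contraction on all of \<open>[0,T]\<close>.\<close>
  define E where "E = (\<lambda>(Z :: real \<Rightarrow>\<^sub>C (real^'d)) r. exp (2 * L * r) *\<^sub>R apply_bcontfun Z r)"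
  \<comment> \<open>The integral equation in a single formula: for \<open>s \<le> t\<close> the
    integral is over a point and \<open>\<gamma> s\<close> remains, for \<open>s \<ge> t\<close> the
    first term is \<open>\<gamma> t\<close>.\<close>
  define Y where "Y = (\<lambda>Z s. \<gamma> (min s t) + integral {t..max t s} (\<lambda>\<sigma>. F (path_upto (E Z) \<sigma>) (u \<sigma>)))"
  \<comment> \<open>Clamping time to [0,T] extends the weighted iterate to a bounded continuous
    function on the whole line.\<close>
  define c where "c = (\<lambda>r::real. max 0 (min T r))"
  define P where "P = (\<lambda>Z. Bcontfun (\<lambda>r. exp (- (2 * L * c r)) *\<^sub>R Y Z (c r)))"
  have c: "c r \<in> {0..T}" for r
    using t by (auto simp: c_def)
  have c_id: "c r = r" if "r \<in> {0..T}" for r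
    using that by (auto simp: c_def)
  have E: "continuous_on {0..T} (E Z)" for Z
    unfolding E_def by (auto intro!: continuous_intros)
  have int: "(\<lambda>\<sigma>. F (path_upto (E Z) \<sigma>) (u \<sigma>)) integrable_on {t..s}" if "s \<le> T" for Z s
    using that t by (intro lipschitz_integrand_integrable[OF F L_nonneg E _ _ u']) auto
  have Y: "continuous_on {0..T} (Y Z)" for Z
  proof -
    have "continuous_on {0..T} (\<lambda>s. \<gamma> (min s t))"
      using t by (intro continuous_on_compose2[OF \<gamma>]) (auto intro!: continuous_intros)
    moreover have "continuous_on {0..T} (\<lambda>s. integral {t..max t s} (\<lambda>\<sigma>. F (path_upto (E Z) \<sigma>) (u \<sigma>)))"
      using t by (intro continuous_on_compose2[OF indefinite_integral_continuous_1[OF int[of T]]])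
        (auto intro!: continuous_intros)
    ultimately show ?thesis
      unfolding Y_def by (intro continuous_intros)
  qed
  have P: "apply_bcontfun (P Z) r = exp (- (2 * L * c r)) *\<^sub>R Y Z (c r)" for Z r
  proof -
    let ?f = "\<lambda>s. exp (- (2 * L * s)) *\<^sub>R Y Z s"
    have f: "continuous_on {0..T} ?f"
      by (intro continuous_intros Y)
    have "compact (?f ` {0..T})"
      using f by (intro compact_continuous_image) auto
    then obtain B where B: "\<And>s. s \<in> {0..T} \<Longrightarrow> norm (?f s) \<le> B"
      by (meson bounded_iff compact_imp_bounded image_eqI)
    have "(\<lambda>r. ?f (c r)) \<in> bcontfun"
    proof (rule bcontfun_normI)
      show "continuous_on UNIV (\<lambda>r. ?f (c r))"
        using c by (intro continuous_on_compose2[OF f]) (auto simp: c_def intro!: continuous_intros)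
    qed (use B c in blast)
    then show ?thesis
      unfolding P_def by (simp add: Bcontfun_inverse)
  qed
  have contr: "dist (P Z) (P Z') \<le> 1 / 2 * dist Z Z'" for Z Z'
  proof (rule dist_bound)
    fix r
    define s where "s = c r"
    have s: "s \<in> {0..T}"
      using c by (simp add: s_def)
    have diff: "norm (Y Z s - Y Z' s) \<le> dist Z Z' / 2 * exp (2 * L * s)"
    proof (cases "t \<le> s")
      case True
      have "Y Z s - Y Z' s = integral {t..s} (\<lambda>\<sigma>. F (path_upto (E Z) \<sigma>) (u \<sigma>) - F (path_upto (E Z') \<sigma>) (u \<sigma>))"
        using True s int by (subst Henstock_Kurzweil_Integration.integral_diff) (auto simp: Y_def max_def)
      also have "norm \<dots> \<le> dist Z Z' / 2 * exp (2 * L * s)"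
      proof (rule norm_integral_exp_le)
        fix \<sigma> assume \<sigma>: "\<sigma> \<in> {t..s}"
        show "norm (F (path_upto (E Z) \<sigma>) (u \<sigma>) - F (path_upto (E Z') \<sigma>) (u \<sigma>))
            \<le> L * (dist Z Z' * exp (2 * L * \<sigma>))"
        proof (rule lipschitz_integrand_diff[OF F L_nonneg E E])
          fix r assume r: "r \<in> {0..\<sigma>}"
          have "norm (E Z r - E Z' r) = exp (2 * L * r) * dist (apply_bcontfun Z r) (apply_bcontfun Z' r)"
            by (simp add: E_def dist_norm flip: scaleR_diff_right)
          also have "\<dots> \<le> exp (2 * L * \<sigma>) * dist Z Z'"
            using r L_pos by (intro mult_mono dist_bounded) auto
          finally show "norm (E Z r - E Z' r) \<le> dist Z Z' * exp (2 * L * \<sigma>)"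
            by (simp add: mult.commute)
        qed (use \<sigma> s t in auto)
      qed (use True L_pos s int in \<open>auto intro!: integrable_diff\<close>)
      finally show ?thesis .
    next
      case False
      then show ?thesis
        by (simp add: Y_def max_def)
    qed
    have "dist (apply_bcontfun (P Z) r) (apply_bcontfun (P Z') r) = exp (- (2 * L * s)) * norm (Y Z s - Y Z' s)"
      by (simp add: P s_def dist_norm flip: scaleR_diff_right)
    also have "\<dots> \<le> exp (- (2 * L * s)) * (dist Z Z' / 2 * exp (2 * L * s))"
      using diff by (intro mult_left_mono) auto
    also have "\<dots> = 1 / 2 * dist Z Z'"
      by (simp add: exp_minus)
    finally show "dist (apply_bcontfun (P Z) r) (apply_bcontfun (P Z') r) \<le> 1 / 2 * dist Z Z'" .
  qed
  obtain Z where Z: "P Z = Z"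
    using banach_fix_type[of "1 / 2" P] contr by (auto simp: P_def)
  \<comment> \<open>The fixed point is unweighted and cut off outside [0,T], as trajectories are
    extensional.\<close>
  define X where "X = restrict (E Z) {0..T}"
  have X: "X s = Y Z s" if "s \<in> {0..T}" for s
  proof -
    have "X s = exp (2 * L * s) *\<^sub>R apply_bcontfun (P Z) s"
      using that by (simp add: X_def E_def Z)
    also have "\<dots> = Y Z s"
      using that by (simp add: P c_id exp_minus)
    finally show ?thesis .
  qed
  have upto: "path_upto X \<sigma> = path_upto (E Z) \<sigma>" if "\<sigma> \<le> T" for \<sigma>
    using that by (intro path_upto_cong) (auto simp: X_def)
  have "is_trajectory T F p u X"
    unfolding is_trajectory_iff[OF p u] t_def[symmetric] \<gamma>_def[symmetric]
  proof (intro conjI ballI)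
    show "X \<in> extensional {0..T}"
      by (simp add: X_def)
    show "continuous_on {0..T} X"
      by (rule continuous_on_eq[OF E[of Z]]) (simp add: X_def)
    show "X s = \<gamma> s" if "s \<in> {0..t}" for s
      using that t by (cases "s = t") (auto simp: X Y_def max_def)
    show "X s = \<gamma> t + integral {t..s} (\<lambda>\<sigma>. F (path_upto X \<sigma>) (u \<sigma>))" if "s \<in> {t..T}" for s
    proof -
      have "integral {t..s} (\<lambda>\<sigma>. F (path_upto X \<sigma>) (u \<sigma>))
          = integral {t..s} (\<lambda>\<sigma>. F (path_upto (E Z) \<sigma>) (u \<sigma>))"
        using that by (intro integral_cong) (simp add: upto)
      then show ?thesis
        using that t by (cases "s = t") (auto simp: X Y_def max_def min_def)
    qed
  qed
  then show ?thesis
    by blast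
qed

text \<open>\<open>weighted_gronwall\<close> for \<open>norm (X s - X' s)\<close>, with
  \<open>a\<close> the gap between the initial paths; both trajectories use the same control. The
  case \<open>a = 0\<close> is uniqueness, the general case drives the Lipschitz estimate for
  \<open>V\<close>.\<close>

lemma trajectory_stability:
  assumes p: "p \<in> cont_from T 0" "p' \<in> cont_from T 0" "fst p = fst p'"
    and u: "u \<in> controls T (fst p)"
    and X: "is_trajectory T F p u X" "is_trajectory T F p' u X'"
    and a: "\<And>r. r \<in> {0..fst p} \<Longrightarrow> norm (snd p r - snd p' r) \<le> a"
    and s: "s \<in> {0..T}"
  shows "norm (X s - X' s) \<le> 2 * a * exp (2 * L * T)"
proof -
  define t where "t = fst p"
  have t: "0 \<le> t" "t \<le> T"
    using cont_fromD[OF p(1)] by (auto simp: t_def)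
  have u': "u \<in> controls T (fst p')"
    using u p by simp
  note X1 = X(1)[unfolded is_trajectory_iff[OF p(1) u]]
  note X2 = X(2)[unfolded is_trajectory_iff[OF p(2) u']]
  have c: "continuous_on {0..T} X" "continuous_on {0..T} X'"
    using X1 X2 by auto
  have a0: "0 \<le> a"
    using a[of 0] t norm_ge_zero[of "snd p 0 - snd p' 0"] unfolding t_def
    by (metis atLeastAtMost_iff order.refl order.trans)
  have "norm (X s - X' s) \<le> 2 * a * exp (2 * L * s)"
  proof (rule weighted_gronwall[where T = T])
    show "continuous_on {0..T} (\<lambda>s. norm (X s - X' s))"
      using c by (intro continuous_intros)
    fix W s
    assume W: "0 \<le> W" "\<And>r. r \<in> {0..T} \<Longrightarrow> norm (X r - X' r) \<le> W * exp (2 * L * r)"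
      and s: "s \<in> {0..T}"
    show "norm (X s - X' s) \<le> a + W / 2 * exp (2 * L * s)"
    proof (cases "s \<le> t")
      case True
      then have "norm (X s - X' s) \<le> a"
        using X1 X2 p(3) s a by (auto simp: t_def)
      moreover have "0 \<le> W / 2 * exp (2 * L * s)"
        using W by simp
      ultimately show ?thesis
        by linarith
    next
      case False
      then have st: "s \<in> {t..T}"
        using s by simp
      have int: "(\<lambda>\<sigma>. F (path_upto Z \<sigma>) (u \<sigma>)) integrable_on {t..s}" if "continuous_on {0..T} Z" for Z
        using st t u that by (intro lipschitz_integrand_integrable[OF F L_nonneg that, of t]) (auto simp: t_def)
      define D where "D = (\<lambda>\<sigma>. F (path_upto X \<sigma>) (u \<sigma>) - F (path_upto X' \<sigma>) (u \<sigma>))"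
      have "integral {t..s} D = integral {t..s} (\<lambda>\<sigma>. F (path_upto X \<sigma>) (u \<sigma>))
          - integral {t..s} (\<lambda>\<sigma>. F (path_upto X' \<sigma>) (u \<sigma>))"
        unfolding D_def using int c by (intro Henstock_Kurzweil_Integration.integral_diff)
      then have eq: "X s - X' s = (snd p t - snd p' t) + integral {t..s} D"
        using X1 X2 p(3) st by (auto simp: t_def)
      have "norm (integral {t..s} D) \<le> W / 2 * exp (2 * L * s)"
      proof (rule norm_integral_exp_le)
        show "D integrable_on {t..s}"
          unfolding D_def using int c by (intro integrable_diff)
        fix \<sigma> assume \<sigma>: "\<sigma> \<in> {t..s}"
        show "norm (D \<sigma>) \<le> L * (W * exp (2 * L * \<sigma>))"
          unfolding D_def
        proof (rule lipschitz_integrand_diff[OF F L_nonneg c])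
          fix r assume r: "r \<in> {0..\<sigma>}"
          have "norm (X r - X' r) \<le> W * exp (2 * L * r)"
            using r \<sigma> st by (intro W) auto
          also have "\<dots> \<le> W * exp (2 * L * \<sigma>)"
            using r W L_pos by (intro mult_left_mono) auto
          finally show "norm (X r - X' r) \<le> W * exp (2 * L * \<sigma>)" .
        qed (use \<sigma> st t in auto)
      qed (use st L_pos W in auto)
      moreover have "norm (snd p t - snd p' t) \<le> a"
        using a t by (simp add: t_def)
      ultimately show ?thesis
        unfolding eq by (meson add_mono norm_triangle_le)
    qed
  qed (use s a0 L_pos in auto)
  also have "\<dots> \<le> 2 * a * exp (2 * L * T)"
    using s a0 L_pos by (intro mult_left_mono) auto
  finally show ?thesis .
qed

text \<open>Stability with gap 0 makes two trajectories agree on [0,T] and extensionality settles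
  the rest, so the definite description in \<open>trajectory\<close> is determined.\<close>

lemma trajectory_eqI:
  assumes p: "p \<in> cont_from T 0" and u: "u \<in> controls T (fst p)"
    and X: "is_trajectory T F p u X"
  shows "trajectory T F p u = X"
  unfolding trajectory_def
proof (rule the_equality)
  show "is_trajectory T F p u X"
    by (rule X)
next
  fix Y assume Y: "is_trajectory T F p u Y"
  have "norm (Y s - X s) \<le> 2 * 0 * exp (2 * L * T)" if "s \<in> {0..T}" for s
    using that by (intro trajectory_stability[OF p p refl u Y X]) auto
  then show "Y = X"
    using X Y by (intro extensionalityI[of _ "{0..T}"]) (auto simp: is_trajectory_def)
qed

lemma is_trajectory_trajectory:
  assumes "p \<in> cont_from T 0" "u \<in> controls T (fst p)"
  shows "is_trajectory T F p u (trajectory T F p u)"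
  using trajectory_exists[OF assms] trajectory_eqI[OF assms] by auto

lemma trajectory_continuous:
  assumes "p \<in> cont_from T 0" "u \<in> controls T (fst p)"
  shows "continuous_on {0..T} (trajectory T F p u)"
  using is_trajectory_trajectory[OF assms] by (simp add: is_trajectory_def)

lemma trajectory_initial:
  assumes "p \<in> cont_from T 0" "u \<in> controls T (fst p)" "s \<in> {0..fst p}"
  shows "trajectory T F p u s = snd p s"
  using is_trajectory_trajectory[OF assms(1,2)] assms(3) by (simp add: is_trajectory_def)

lemma trajectory_integrable:
  fixes G :: "'d path \<Rightarrow> 'u \<Rightarrow> 'b::euclidean_space"
  assumes "lipschitz_integrand T L G" "p \<in> cont_from T 0" "u \<in> controls T (fst p)" "fst p \<le> a" "b \<le> T"
  shows "(\<lambda>\<sigma>. G (path_upto (trajectory T F p u) \<sigma>) (u \<sigma>)) absolutely_integrable_on {a..b}"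
    and "(\<lambda>\<sigma>. G (path_upto (trajectory T F p u) \<sigma>) (u \<sigma>)) integrable_on {a..b}"
  using assms cont_fromD[OF assms(2)]
  by (auto intro!: lipschitz_integrand_integrable[OF assms(1) L_nonneg trajectory_continuous, where t = "fst p"])

lemma trajectory_increment:
  assumes p: "p \<in> cont_from T 0" and u: "u \<in> controls T (fst p)" and s: "fst p \<le> s" "s \<le> s'" "s' \<le> T"
  defines "X \<equiv> trajectory T F p u"
  shows "X s' - X s = integral {s..s'} (\<lambda>\<sigma>. F (path_upto X \<sigma>) (u \<sigma>))"
proof -
  have "integral {fst p..s} (\<lambda>\<sigma>. F (path_upto X \<sigma>) (u \<sigma>)) + integral {s..s'} (\<lambda>\<sigma>. F (path_upto X \<sigma>) (u \<sigma>))
      = integral {fst p..s'} (\<lambda>\<sigma>. F (path_upto X \<sigma>) (u \<sigma>))"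
    unfolding X_def using s p u by (intro Henstock_Kurzweil_Integration.integral_combine trajectory_integrable[OF F]) auto
  then show ?thesis
    using is_trajectory_trajectory[OF p u] s unfolding is_trajectory_iff[OF p u] X_def[symmetric] by (auto simp: algebra_simps)
qed

text \<open>Adding 1 to the norm turns linear growth \<open>L * (1 + B)\<close> into a homogeneous
  bound to which \<open>weighted_gronwall\<close> applies. The result does not depend on the
  control, which is what makes later time steps uniform in it.\<close>

lemma trajectory_bound:
  assumes p: "p \<in> cont_from T 0" and u: "u \<in> controls T (fst p)" and s: "s \<in> {0..T}"
  shows "1 + norm (trajectory T F p u s) \<le> 2 * (1 + sup_norm p) * exp (2 * L * T)"
proof -
  define X where "X = trajectory T F p u"
  define t where "t = fst p"
  have t: "0 \<le> t" "t \<le> T"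
    using cont_fromD[OF p] by (auto simp: t_def)
  have c: "continuous_on {0..T} X"
    unfolding X_def using p u by (rule trajectory_continuous)
  have init: "norm (X s) \<le> sup_norm p" if "s \<in> {0..t}" for s
    using that trajectory_initial[OF p u, of s] norm_le_sup_norm[OF cont_fromD(5)[OF p], of s]
    by (simp add: X_def t_def)
  have a0: "0 \<le> 1 + sup_norm p"
    using order_trans[OF norm_ge_zero init[of 0]] t by auto
  have "1 + norm (X s) \<le> 2 * (1 + sup_norm p) * exp (2 * L * s)"
  proof (rule weighted_gronwall[where T = T])
    show "continuous_on {0..T} (\<lambda>s. 1 + norm (X s))"
      using c by (intro continuous_intros)
    fix W s
    assume W: "0 \<le> W" "\<And>r. r \<in> {0..T} \<Longrightarrow> 1 + norm (X r) \<le> W * exp (2 * L * r)"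
      and s: "s \<in> {0..T}"
    show "1 + norm (X s) \<le> 1 + sup_norm p + W / 2 * exp (2 * L * s)"
    proof (cases "s \<le> t")
      case True
      then show ?thesis
        using init[of s] s W by (simp add: add_increasing2)
    next
      case False
      have eq: "X s = X t + integral {t..s} (\<lambda>\<sigma>. F (path_upto X \<sigma>) (u \<sigma>))"
        using trajectory_increment[OF p u, of t s] False s unfolding X_def t_def by (simp add: algebra_simps)
      have "norm (integral {t..s} (\<lambda>\<sigma>. F (path_upto X \<sigma>) (u \<sigma>))) \<le> W / 2 * exp (2 * L * s)"
      proof (rule norm_integral_exp_le)
        show "(\<lambda>\<sigma>. F (path_upto X \<sigma>) (u \<sigma>)) integrable_on {t..s}"
          unfolding X_def t_def using s p u by (intro trajectory_integrable[OF F]) auto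
        fix \<sigma> assume \<sigma>: "\<sigma> \<in> {t..s}"
        have "norm (F (path_upto X \<sigma>) (u \<sigma>)) \<le> L * (1 + (W * exp (2 * L * \<sigma>) - 1))"
        proof (rule lipschitz_integrand_growth[OF F L_nonneg c])
          fix r assume r: "r \<in> {0..\<sigma>}"
          have "1 + norm (X r) \<le> W * exp (2 * L * r)"
            using r \<sigma> s by (intro W) auto
          also have "\<dots> \<le> W * exp (2 * L * \<sigma>)"
            using r W L_pos by (intro mult_left_mono) auto
          finally show "norm (X r) \<le> W * exp (2 * L * \<sigma>) - 1"
            by simp
        qed (use \<sigma> s t in auto)
        then show "norm (F (path_upto X \<sigma>) (u \<sigma>)) \<le> L * (W * exp (2 * L * \<sigma>))"
          by simp
      qed (use False L_pos W in auto)
      moreover have "norm (X t) \<le> sup_norm p"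
        using init t by simp
      ultimately show ?thesis
        unfolding eq by (smt (verit) norm_triangle_ineq)
    qed
  qed (use s a0 L_pos in auto)
  also have "\<dots> \<le> 2 * (1 + sup_norm p) * exp (2 * L * T)"
    using s a0 L_pos by (intro mult_left_mono) auto
  finally show ?thesis
    by (simp add: X_def)
qed

end

section \<open>Dynamic programming\<close>

lemma controls_mono:
  assumes "u \<in> controls T t" "t \<le> s"
  shows "u \<in> controls T s"
  using assms unfolding controls_def by (elim measurable_restrict_mono) auto

lemma controls_const: "(\<lambda>_. v) \<in> controls T t"
  by (simp add: controls_def)

lemma controls_concat:
  assumes u: "u \<in> controls T t" and v: "v \<in> controls T s"
  shows "(\<lambda>r. if r \<le> s then u r else v r) \<in> controls T t"
proof -
  have "u \<in> borel_measurable (lebesgue_on ({t..T} \<inter> {r. r \<le> s}))"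
    using u unfolding controls_def by (elim measurable_restrict_mono) auto
  moreover have "v \<in> borel_measurable (lebesgue_on ({t..T} \<inter> {r. \<not> r \<le> s}))"
    using v unfolding controls_def by (elim measurable_restrict_mono) auto
  moreover have "{x \<in> space (lebesgue_on {t..T}). x \<le> s} \<in> sets (lebesgue_on {t..T})"
  proof -
    have "{x \<in> space (lebesgue_on {t..T}). x \<le> s} = {t..T} \<inter> {..s}"
      by (auto simp: space_restrict_space)
    also have "\<dots> \<in> sets (lebesgue_on {t..T})"
      by (auto simp: sets_restrict_space)
    finally show ?thesis .
  qed
  ultimately show ?thesis
    unfolding controls_def
    by (subst measurable_If_restrict_space_iff) (auto simp: restrict_restrict_space)
qed

context control_problem
begin

abbreviation "V \<equiv> value_functional T F q \<phi>"
abbreviation "J \<equiv> cost T F q \<phi>"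
abbreviation "traj \<equiv> trajectory T F"
abbreviation running_cost where
  "running_cost p u s s' \<equiv> integral {s..s'} (\<lambda>\<sigma>. q (path_upto (traj p u) \<sigma>) (u \<sigma>))"

lemma traj_path_upto:
  assumes "p \<in> cont_from T 0" "u \<in> controls T (fst p)" "0 \<le> s" "s \<le> T"
  shows "path_upto (traj p u) s \<in> cont_from T 0"
  using trajectory_continuous[OF assms(1,2)] assms(3,4) by (intro path_upto_cont_from) auto

text \<open>Additivity of the integral shows that the old trajectory also solves the equation
  restarted at \<open>s\<close> from its own past; uniqueness does the rest.\<close>

lemma trajectory_flow:
  assumes p: "p \<in> cont_from T 0" and u: "u \<in> controls T (fst p)" and s: "fst p \<le> s" "s \<le> T"
  shows "traj (path_upto (traj p u) s) u = traj p u"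
proof -
  define X where "X = traj p u"
  define p' where "p' = path_upto X s"
  have s0: "0 \<le> s"
    using s cont_fromD[OF p] by auto
  have p': "p' \<in> cont_from T 0" and fst: "fst p' = s"
    unfolding p'_def X_def using p u s s0 by (auto intro: traj_path_upto)
  have u': "u \<in> controls T (fst p')"
    using u s fst by (auto intro: controls_mono)
  have "is_trajectory T F p' u X"
    unfolding is_trajectory_iff[OF p' u'] fst
  proof (intro conjI ballI)
    show "X s' = snd p' s + integral {s..s'} (\<lambda>\<sigma>. F (path_upto X \<sigma>) (u \<sigma>))" if "s' \<in> {s..T}" for s'
      using that s s0 trajectory_increment[OF p u, of s s'] by (simp add: p'_def X_def algebra_simps)
  qed (use is_trajectory_trajectory[OF p u] in \<open>auto simp: X_def p'_def is_trajectory_def\<close>)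
  then show ?thesis
    using trajectory_eqI[OF p' u'] by (simp add: p'_def X_def)
qed

lemma cost_eq:
  assumes "p \<in> cont_from T 0" "u \<in> controls T (fst p)"
  shows "J p u = running_cost p u (fst p) T + \<phi> (path_upto (traj p u) T)"
  unfolding cost_def
  using set_lebesgue_integral_eq_integral(2)[OF trajectory_integrable(1)[OF q assms order.refl order.refl]]
  by simp

lemma cost_split:
  assumes p: "p \<in> cont_from T 0" and u: "u \<in> controls T (fst p)" and s: "fst p \<le> s" "s \<le> T"
  shows "J p u = running_cost p u (fst p) s + J (path_upto (traj p u) s) u"
proof -
  have s0: "0 \<le> s"
    using s cont_fromD[OF p] by auto
  have "running_cost p u (fst p) T = running_cost p u (fst p) s + running_cost p u s T"
    using s p u
    by (intro Henstock_Kurzweil_Integration.integral_combine[symmetric] trajectory_integrable[OF q]) auto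
  moreover have "J (path_upto (traj p u) s) u
      = running_cost p u s T + \<phi> (path_upto (traj p u) T)"
    using trajectory_flow[OF assms] controls_mono[OF u s(1)]
    by (subst cost_eq) (auto intro!: traj_path_upto p u s s0)
  ultimately show ?thesis
    using cost_eq[OF p u] by simp
qed

text \<open>The trajectory \<open>Y\<close> started at time \<open>s\<close> with control
  \<open>v\<close> already contains the past up to \<open>s\<close>, so \<open>Y\<close> itself is
  the trajectory of the pasted control \<open>w\<close>. The cost then splits at
  \<open>s\<close>.\<close>

lemma cost_concat:
  assumes p: "p \<in> cont_from T 0" and u: "u \<in> controls T (fst p)" and s: "fst p \<le> s" "s \<le> T"
    and v: "v \<in> controls T s"
  defines "w \<equiv> \<lambda>r. if r \<le> s then u r else v r"
  shows "J p w = running_cost p u (fst p) s + J (path_upto (traj p u) s) v"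
proof -
  define X where "X = traj p u"
  define p' where "p' = path_upto X s"
  define Y where "Y = traj p' v"
  have s0: "0 \<le> s"
    using s cont_fromD[OF p] by auto
  have p': "p' \<in> cont_from T 0" and fst: "fst p' = s"
    unfolding p'_def X_def using p u s s0 by (auto intro: traj_path_upto)
  have v': "v \<in> controls T (fst p')"
    using v by (simp add: fst)
  have w: "w \<in> controls T (fst p)"
    unfolding w_def using u v by (rule controls_concat)
  have w': "w \<in> controls T s"
    using w s(1) by (rule controls_mono)
  have Y: "continuous_on {0..T} Y"
    unfolding Y_def using p' v' by (rule trajectory_continuous)
  have XY: "Y r = X r" if "r \<in> {0..s}" for r
    unfolding Y_def using that p' v' fst by (subst trajectory_initial) (auto simp: p'_def)
  have upto: "path_upto Y \<sigma> = path_upto X \<sigma>" if "\<sigma> \<le> s" for \<sigma>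
    using that XY by (intro path_upto_cong) auto
  \<comment> \<open>At time \<open>s\<close> itself \<open>w\<close> still takes the value of
    \<open>u\<close>; one point does not affect the integral.\<close>
  have spike: "integral {s..r} (\<lambda>\<sigma>. G (path_upto Y \<sigma>) (w \<sigma>)) = integral {s..r} (\<lambda>\<sigma>. G (path_upto Y \<sigma>) (v \<sigma>))"
    for r and G :: "'d path \<Rightarrow> 'u \<Rightarrow> 'b::euclidean_space"
    by (rule integral_spike[of "{s}"]) (auto simp: w_def)
  have early: "integral {fst p..r} (\<lambda>\<sigma>. G (path_upto Y \<sigma>) (w \<sigma>)) = integral {fst p..r} (\<lambda>\<sigma>. G (path_upto X \<sigma>) (u \<sigma>))"
    if "r \<le> s" for r and G :: "'d path \<Rightarrow> 'u \<Rightarrow> 'b::euclidean_space"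
    using that by (intro integral_cong) (auto simp: w_def upto)
  have X: "is_trajectory T F p u X"
    unfolding X_def using p u by (rule is_trajectory_trajectory)
  have "is_trajectory T F p w Y"
    unfolding is_trajectory_iff[OF p w]
  proof (intro conjI ballI Y)
    show "Y \<in> extensional {0..T}"
      using is_trajectory_trajectory[OF p' v'] by (simp add: Y_def is_trajectory_def)
    show "Y r = snd p r" if "r \<in> {0..fst p}" for r
      using that X s by (simp add: XY is_trajectory_def)
    fix r assume r: "r \<in> {fst p..T}"
    show "Y r = snd p (fst p) + integral {fst p..r} (\<lambda>\<sigma>. F (path_upto Y \<sigma>) (w \<sigma>))"
    proof (cases "r \<le> s")
      case True
      then show ?thesis
        using r cont_fromD(1)[OF p] X early[OF True, of F]
        unfolding is_trajectory_iff[OF p u] by (simp add: XY)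
    next
      case False
      have "integral {fst p..r} (\<lambda>\<sigma>. F (path_upto Y \<sigma>) (w \<sigma>))
        = integral {fst p..s} (\<lambda>\<sigma>. F (path_upto Y \<sigma>) (w \<sigma>)) + integral {s..r} (\<lambda>\<sigma>. F (path_upto Y \<sigma>) (w \<sigma>))"
        using False s r cont_fromD[OF p]
        by (intro Henstock_Kurzweil_Integration.integral_combine[symmetric]
            lipschitz_integrand_integrable[OF F L_nonneg Y _ _ w]) auto
      also have "\<dots> = (X s - snd p (fst p)) + (Y r - Y s)"
        using X s r False trajectory_increment[OF p' v', of s r] early[of s F] spike[of r F]
        unfolding is_trajectory_iff[OF p u] by (simp add: Y_def fst)
      finally show ?thesis
        using XY[of s] s0 by simp
    qed
  qed
  then have Yw: "traj p w = Y"
    using trajectory_eqI[OF p w] by simp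
  have p'Y: "p' = path_upto Y s"
    using upto[of s] by (simp add: p'_def)
  \<comment> \<open>Restarting the \<open>w\<close>-trajectory at \<open>s\<close> gives back
    \<open>Y\<close>, which is also the \<open>v\<close>-trajectory from \<open>p'\<close>; so
    \<open>w\<close> and \<open>v\<close> have the same cost from \<open>p'\<close>.\<close>
  have "traj p' w = Y"
    using trajectory_flow[OF p w s] by (simp add: Yw p'Y)
  then have "J p' w = J p' v"
    using cost_eq[OF p', of w] cost_eq[OF p' v'] w' spike[of T q] by (simp add: fst Y_def)
  then have "J p w = running_cost p w (fst p) s + J p' v"
    using cost_split[OF p w s] by (simp add: Yw p'Y)
  also have "running_cost p w (fst p) s = running_cost p u (fst p) s"
    using early[of s q] by (simp add: Yw X_def)
  finally show "J p w = running_cost p u (fst p) s + J (path_upto (traj p u) s) v"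
    by (simp add: p'_def X_def)
qed

lemma running_cost_bound:
  assumes p: "p \<in> cont_from T 0" and u: "u \<in> controls T (fst p)" and s: "fst p \<le> s" "s \<le> s'" "s' \<le> T"
    and B: "\<And>r. r \<in> {0..s'} \<Longrightarrow> norm (traj p u r) \<le> B"
  shows "\<bar>running_cost p u s s'\<bar> \<le> L * (1 + B) * (s' - s)"
proof -
  have "norm (running_cost p u s s') \<le> L * (1 + B) * (s' - s)"
  proof (rule norm_integral_le_const)
    show "(\<lambda>\<sigma>. q (path_upto (traj p u) \<sigma>) (u \<sigma>)) integrable_on {s..s'}"
      using s p u by (intro trajectory_integrable[OF q]) auto
    show "norm (q (path_upto (traj p u) \<sigma>) (u \<sigma>)) \<le> L * (1 + B)" if "\<sigma> \<in> {s..s'}" for \<sigma>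
      using that s cont_fromD[OF p] B
      by (intro lipschitz_integrand_growth[OF q L_nonneg trajectory_continuous[OF p u]]) auto
  qed (use s in auto)
  then show ?thesis
    by simp
qed

text \<open>The bound \<open>B\<close> is asked only up to \<open>s'\<close>. This allows two uses:
  with the a priori bound it gives a speed common to all controls, and with \<open>B = M\<close> on
  a short interval it gives the sharper \<open>L * (1 + M)\<close>.\<close>

lemma trajectory_lipschitz:
  assumes p: "p \<in> cont_from T 0" and u: "u \<in> controls T (fst p)" and s: "fst p \<le> s" "s \<le> s'" "s' \<le> T"
    and B: "\<And>r. r \<in> {0..s'} \<Longrightarrow> norm (traj p u r) \<le> B"
  shows "norm (traj p u s' - traj p u s) \<le> L * (1 + B) * (s' - s)"
  unfolding trajectory_increment[OF p u s]
proof (rule norm_integral_le_const)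
  show "(\<lambda>\<sigma>. F (path_upto (traj p u) \<sigma>) (u \<sigma>)) integrable_on {s..s'}"
    using s p u by (intro trajectory_integrable[OF F]) auto
  show "norm (F (path_upto (traj p u) \<sigma>) (u \<sigma>)) \<le> L * (1 + B)" if "\<sigma> \<in> {s..s'}" for \<sigma>
    using that s cont_fromD[OF p] B
    by (intro lipschitz_integrand_growth[OF F L_nonneg trajectory_continuous[OF p u]]) auto
qed (use s in auto)

section \<open>The value functional and the dynamic programming principle\<close>

lemma cost_bdd_below:
  assumes p: "p \<in> cont_from T 0"
  shows "bdd_below (J p ` controls T (fst p))"
proof -
  \<comment> \<open>\<open>trajectory_bound\<close> bounds 1 plus the norm by \<open>R\<close>, so
    the norm itself is at most \<open>R - 1\<close>.\<close>
  define R where "R = 2 * (1 + sup_norm p) * exp (2 * L * T)"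
  have "- (L * R * (T - fst p)) - L * R \<le> J p u" if u: "u \<in> controls T (fst p)" for u
  proof -
    have B: "norm (traj p u r) \<le> R - 1" if "r \<in> {0..T}" for r
      using trajectory_bound[OF p u that] by (simp add: R_def)
    have "\<bar>running_cost p u (fst p) T\<bar> \<le> L * (1 + (R - 1)) * (T - fst p)"
      using cont_fromD[OF p] B by (intro running_cost_bound p u) auto
    moreover have "\<bar>\<phi> (path_upto (traj p u) T)\<bar> \<le> L * (1 + sup_norm (path_upto (traj p u) T))"
      using trajectory_continuous[OF p u] by (intro phi_growth path_upto_cont_at) auto
    moreover have "L * (1 + sup_norm (path_upto (traj p u) T)) \<le> L * (1 + (R - 1))"
      using B T_pos L_pos by (intro mult_left_mono add_left_mono sup_norm_path_upto_le) auto
    ultimately show ?thesis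
      unfolding cost_eq[OF p u] by simp
  qed
  then show ?thesis
    by (auto intro!: bdd_belowI)
qed

lemma value_le_cost:
  assumes "p \<in> cont_from T 0" "u \<in> controls T (fst p)"
  shows "V p \<le> J p u"
  unfolding value_functional_def using cost_bdd_below assms by (intro cINF_lower) auto

lemma value_near_cost:
  assumes "p \<in> cont_from T 0" "0 < e"
  obtains u where "u \<in> controls T (fst p)" "J p u < V p + e"
proof -
  have "Inf (J p ` controls T (fst p)) < V p + e"
    using assms by (simp add: value_functional_def)
  moreover have "J p ` controls T (fst p) \<noteq> {}"
    using controls_const by auto
  ultimately show ?thesis
    using that cInf_lessD[of "J p ` controls T (fst p)" "V p + e"] by auto
qed

lemma value_terminal:
  assumes p: "p \<in> cont_at T"
  shows "V p = \<phi> p"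
proof -
  have p': "p \<in> cont_from T 0" "fst p = T"
    using p T_pos by (auto simp: cont_from_def cont_at_def)
  have "J p u = \<phi> p" if u: "u \<in> controls T T" for u
  proof -
    have "path_upto (traj p u) T = p"
      using p p' u by (intro path_upto_eqI p trajectory_initial) auto
    then show ?thesis
      using cost_eq[OF p'(1), of u] u p' by simp
  qed
  then have "J p ` controls T T = {\<phi> p}"
    using controls_const[of _ T T] by force
  then show ?thesis
    by (simp add: value_functional_def p')
qed

text \<open>The given control up to \<open>s\<close>, followed by a control that is
  \<open>e\<close>-optimal from the state reached there, is a competitor at
  \<open>p\<close>.\<close>

lemma value_dpp_le:
  assumes p: "p \<in> cont_from T 0" and u: "u \<in> controls T (fst p)" and s: "fst p \<le> s" "s \<le> T"
  shows "V p \<le> running_cost p u (fst p) s + V (path_upto (traj p u) s)"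
proof (rule field_le_epsilon)
  fix e :: real assume "e > 0"
  have p': "path_upto (traj p u) s \<in> cont_from T 0"
    using p u s cont_fromD[OF p] by (auto intro!: traj_path_upto)
  obtain v where v: "v \<in> controls T s" "J (path_upto (traj p u) s) v < V (path_upto (traj p u) s) + e"
    using value_near_cost[OF p' \<open>e > 0\<close>] by auto
  have "V p \<le> J p (\<lambda>r. if r \<le> s then u r else v r)"
    using p u v by (intro value_le_cost controls_concat)
  also have "\<dots> = running_cost p u (fst p) s + J (path_upto (traj p u) s) v"
    by (rule cost_concat[OF p u s v(1)])
  finally show "V p \<le> running_cost p u (fst p) s + V (path_upto (traj p u) s) + e"
    using v by simp
qed

text \<open>For an \<open>e\<close>-optimal control at \<open>p\<close>, its remaining part is a
  competitor at the state reached at \<open>s\<close>. The accuracy is left free because it has to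
  be small relative to the step \<open>s - fst p\<close> later.\<close>

lemma value_dpp_ge:
  assumes p: "p \<in> cont_from T 0" and s: "fst p \<le> s" "s \<le> T" and "0 < e"
  obtains u where "u \<in> controls T (fst p)"
    "running_cost p u (fst p) s + V (path_upto (traj p u) s) < V p + e"
proof -
  obtain u where u: "u \<in> controls T (fst p)" "J p u < V p + e"
    using value_near_cost[OF p \<open>0 < e\<close>] by blast
  have "V (path_upto (traj p u) s) \<le> J (path_upto (traj p u) s) u"
    using p u s cont_fromD[OF p] by (intro value_le_cost traj_path_upto) (auto intro: controls_mono)
  then show ?thesis
    using that u cost_split[OF p u(1) s] by force
qed

section \<open>Lipschitz and continuity estimates for the value functional\<close>

definition "V_lip = 2 * L * exp (2 * L * T) * (T + 1)"

text \<open>A control nearly optimal for \<open>p'\<close> is also used at \<open>p\<close>; the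
  equal final times make it admissible there. In \<open>V_lip\<close> the factor
  \<open>2 * exp (2 * L * T)\<close> comes from stability of trajectories, \<open>L * T\<close> from
  the running cost and \<open>L\<close> from the terminal cost.\<close>

lemma value_lipschitz_le:
  assumes p: "p \<in> cont_from T 0" "p' \<in> cont_from T 0" "fst p = fst p'"
    and a: "\<And>r. r \<in> {0..fst p} \<Longrightarrow> norm (snd p r - snd p' r) \<le> a"
  shows "V p \<le> V p' + V_lip * a"
proof (rule field_le_epsilon)
  fix e :: real assume "e > 0"
  obtain u where u': "u \<in> controls T (fst p')" "J p' u < V p' + e"
    using value_near_cost[OF p(2) \<open>e > 0\<close>] by blast
  have u: "u \<in> controls T (fst p)"
    using u' p by simp
  define X where "X = traj p u"
  define X' where "X' = traj p' u"
  define t where "t = fst p"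
  define A where "A = 2 * a * exp (2 * L * T)"
  have t: "0 \<le> t" "t \<le> T"
    using cont_fromD[OF p(1)] by (auto simp: t_def)
  have a0: "0 \<le> a"
    using a[of 0] t norm_ge_zero[of "snd p 0 - snd p' 0"] unfolding t_def
    by (metis atLeastAtMost_iff order.refl order.trans)
  have c: "continuous_on {0..T} X" "continuous_on {0..T} X'"
    unfolding X_def X'_def using p u u' by (auto intro: trajectory_continuous)
  have diff: "norm (X s - X' s) \<le> A" if "s \<in> {0..T}" for s
    unfolding A_def X_def X'_def using u u' p that
    by (intro trajectory_stability[OF p u _ _ a] is_trajectory_trajectory) auto
  have A0: "0 \<le> A"
    using a0 by (simp add: A_def)
  have int: "(\<lambda>\<sigma>. q (path_upto Z \<sigma>) (u \<sigma>)) integrable_on {t..T}" if "continuous_on {0..T} Z" for Z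
    using t u that by (intro lipschitz_integrand_integrable[OF q L_nonneg that, of t]) (auto simp: t_def)
  have "norm (integral {t..T} (\<lambda>\<sigma>. q (path_upto X \<sigma>) (u \<sigma>) - q (path_upto X' \<sigma>) (u \<sigma>))) \<le> L * A * (T - t)"
  proof (rule norm_integral_le_const)
    show "norm (q (path_upto X \<sigma>) (u \<sigma>) - q (path_upto X' \<sigma>) (u \<sigma>)) \<le> L * A" if "\<sigma> \<in> {t..T}" for \<sigma>
      using that t diff by (intro lipschitz_integrand_diff[OF q L_nonneg c]) auto
  qed (use t int c in \<open>auto intro!: integrable_diff\<close>)
  also have "\<dots> \<le> L * A * T"
    using A0 L_pos t by (intro mult_left_mono) auto
  finally have "running_cost p u t T \<le> running_cost p' u t T + L * A * T"
    unfolding Henstock_Kurzweil_Integration.integral_diff[OF int[OF c(1)] int[OF c(2)]] by (simp add: X_def X'_def)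
  moreover have "\<bar>\<phi> (path_upto X T) - \<phi> (path_upto X' T)\<bar> \<le> L * A"
  proof -
    have "\<bar>\<phi> (path_upto X T) - \<phi> (path_upto X' T)\<bar>
        \<le> L * sup_norm (T, \<lambda>r. snd (path_upto X T) r - snd (path_upto X' T) r)"
      using c by (intro phi_lipschitz path_upto_cont_at) auto
    also have "\<dots> \<le> L * A"
      using diff L_pos T_pos by (intro mult_left_mono sup_norm_le) auto
    finally show ?thesis .
  qed
  ultimately have "J p u \<le> J p' u + (L * A * T + L * A)"
    unfolding cost_eq[OF p(1) u] cost_eq[OF p(2) u'(1)] using p(3) by (simp add: X_def X'_def t_def)
  also have "L * A * T + L * A = V_lip * a"
    by (simp add: A_def V_lip_def algebra_simps)
  finally show "V p \<le> V p' + V_lip * a + e"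
    using value_le_cost[OF p(1) u] u'(2) by simp
qed

lemma value_lipschitz:
  assumes p: "p \<in> cont_from T 0" "p' \<in> cont_from T 0" "fst p = fst p'"
    and a: "\<And>r. r \<in> {0..fst p} \<Longrightarrow> norm (snd p r - snd p' r) \<le> a"
  shows "\<bar>V p - V p'\<bar> \<le> V_lip * a"
  using value_lipschitz_le[OF p a] value_lipschitz_le[OF p(2,1) p(3)[symmetric], of a] a p(3)
  by (simp add: norm_minus_commute abs_le_iff)

text \<open>The shorter path \<open>p\<close> is driven to the later time \<open>t'\<close> by any
  control. This costs at most \<open>K * D\<close> and moves the state at most \<open>K * D\<close>
  away from \<open>p\<close> frozen, hence within \<open>(1 + K) * D\<close> of \<open>p'\<close>,
  where paths of equal length can be compared. \<open>K\<close> bounds both speed and running cost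
  for initial paths of norm at most \<open>M\<close>.\<close>

lemma value_d_inf_lipschitz:
  assumes p: "p \<in> cont_from T 0" "p' \<in> cont_from T 0" and le: "fst p \<le> fst p'"
    and M: "sup_norm p \<le> M"
  defines "K \<equiv> L * (2 * (1 + M) * exp (2 * L * T))"
  shows "\<bar>V p - V p'\<bar> \<le> (K + V_lip * (1 + K)) * d_inf p p'"
proof -
  define t where "t = fst p"
  define t' where "t' = fst p'"
  define D where "D = d_inf p p'"
  have t: "0 \<le> t" "t \<le> t'" "t' \<le> T"
    using cont_fromD[OF p(1)] cont_fromD[OF p(2)] le by (auto simp: t_def t'_def)
  have D: "(t' - t) + norm (snd p (min r t) - snd p' r) \<le> D" if "r \<in> {0..t'}" for r
    using that t d_inf_ge[OF cont_fromD(5)[OF p(1)] cont_fromD(5)[OF p(2)], of r]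
    by (simp add: t_def t'_def D_def max_def min_def split: if_splits)
  have D': "t' - t \<le> D" "0 \<le> D"
    using D[of 0] t norm_ge_zero[of "snd p (min 0 t) - snd p' 0"] by (auto simp del: norm_ge_zero)
  have M0: "0 \<le> M"
    using norm_le_sup_norm[OF cont_fromD(5)[OF p(1)], of 0] t M norm_ge_zero[of "snd p 0"]
    by (auto simp: t_def simp del: norm_ge_zero)
  have K0: "0 \<le> K"
    unfolding K_def using M0 L_pos by (intro mult_nonneg_nonneg) auto
  have V0: "0 \<le> V_lip"
    unfolding V_lip_def using L_pos T_pos by (intro mult_nonneg_nonneg) auto
  have main: "\<bar>running_cost p u t t' + V (path_upto (traj p u) t') - V p'\<bar> \<le> (K + V_lip * (1 + K)) * D"
    if u: "u \<in> controls T (fst p)" for u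
  proof -
    define R where "R = 2 * (1 + M) * exp (2 * L * T)"
    have B: "norm (traj p u r) \<le> R - 1" if "r \<in> {0..T}" for r
    proof -
      have "1 + norm (traj p u r) \<le> 2 * (1 + sup_norm p) * exp (2 * L * T)"
        using p(1) u that by (rule trajectory_bound)
      also have "\<dots> \<le> R"
        unfolding R_def using M by (intro mult_right_mono mult_left_mono) auto
      finally show ?thesis
        by simp
    qed
    have K: "K = L * (1 + (R - 1))"
      by (simp add: K_def R_def)
    have "\<bar>running_cost p u t t'\<bar> \<le> K * (t' - t)"
      unfolding K using B t by (intro running_cost_bound p u) (auto simp: t_def)
    also have "\<dots> \<le> K * D"
      using D' K0 by (intro mult_left_mono)
    finally have 1: "\<bar>running_cost p u t t'\<bar> \<le> K * D" .
    have "\<bar>V (path_upto (traj p u) t') - V p'\<bar> \<le> V_lip * ((1 + K) * D)"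
    proof (rule value_lipschitz)
      show "path_upto (traj p u) t' \<in> cont_from T 0"
        using t by (intro traj_path_upto p u) auto
      fix r assume "r \<in> {0..fst (path_upto (traj p u) t')}"
      then have r: "r \<in> {0..t'}"
        by simp
      have "norm (traj p u r - snd p (min r t)) \<le> K * D"
      proof (cases "r \<le> t")
        case True
        then show ?thesis
          using r K0 D' trajectory_initial[OF p(1) u, of r] by (simp add: t_def)
      next
        case False
        have "norm (traj p u r - traj p u t) \<le> K * (r - t)"
          unfolding K using False r t B by (intro trajectory_lipschitz p u) (auto simp: t_def)
        also have "\<dots> \<le> K * D"
          using r K0 D' by (intro mult_left_mono) auto
        finally show ?thesis
          using False t trajectory_initial[OF p(1) u, of t] by (simp add: t_def)
      qed
      moreover have "norm (snd p (min r t) - snd p' r) \<le> D"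
        using D[OF r] t by simp
      ultimately have "norm ((traj p u r - snd p (min r t)) + (snd p (min r t) - snd p' r)) \<le> K * D + D"
        by (intro norm_triangle_mono)
      then show "norm (snd (path_upto (traj p u) t') r - snd p' r) \<le> (1 + K) * D"
        using r by (simp add: algebra_simps)
    qed (use p t'_def in auto)
    with 1 have "\<bar>running_cost p u t t' + V (path_upto (traj p u) t') - V p'\<bar> \<le> K * D + V_lip * ((1 + K) * D)"
      by linarith
    then show ?thesis
      by (simp add: algebra_simps)
  qed
  \<comment> \<open>Any control may be used here since \<open>main\<close> holds for all of them;
    the constant control \<open>undefined\<close> is an arbitrary choice. The reverse inequality
    below uses a nearly optimal one.\<close>
  have "V p \<le> V p' + (K + V_lip * (1 + K)) * D"
    using value_dpp_le[OF p(1) controls_const[of undefined], of t'] t main[OF controls_const[of undefined]]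
    by (simp add: t_def)
  moreover have "V p' \<le> V p + (K + V_lip * (1 + K)) * D"
  proof (rule field_le_epsilon)
    fix e :: real assume "e > 0"
    obtain u where "u \<in> controls T (fst p)"
        "running_cost p u (fst p) t' + V (path_upto (traj p u) t') < V p + e"
      using value_dpp_ge[OF p(1) _ _ \<open>e > 0\<close>, of t'] t by (auto simp: t_def)
    then show "V p' \<le> V p + (K + V_lip * (1 + K)) * D + e"
      using main[of u] by (simp add: t_def)
  qed
  ultimately show ?thesis
    by (simp add: D_def abs_le_iff)
qed

text \<open>The Lipschitz constant depends on the norm of the shorter path, and either path may be
  the shorter one, so a bound valid for all nearby paths is needed.\<close>

lemma value_continuous: "d_inf_continuous_on (cont_from T 0) V"
  unfolding d_inf_continuous_on_def
proof (intro ballI allI impI)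
  fix p :: "'d path" and e :: real
  assume p: "p \<in> cont_from T 0" and "e > 0"
  \<comment> \<open>Covers every \<open>p'\<close> at distance less than 1 from \<open>p\<close>;
    this is the reason for the 1 in the choice of the radius. There \<open>C + 1\<close> replaces
    \<open>C\<close> because \<open>C\<close> might vanish.\<close>
  define M where "M = sup_norm p + 1"
  define K where "K = L * (2 * (1 + M) * exp (2 * L * T))"
  define C where "C = K + V_lip * (1 + K)"
  have p0: "0 \<le> fst p"
    using cont_fromD(1)[OF p] .
  have "0 \<le> M"
    using norm_le_sup_norm[OF cont_fromD(5)[OF p], of 0] p0 norm_ge_zero[of "snd p 0"]
    by (auto simp: M_def simp del: norm_ge_zero)
  then have "0 \<le> K"
    unfolding K_def using L_pos by (intro mult_nonneg_nonneg) auto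
  moreover have "0 \<le> V_lip"
    unfolding V_lip_def using L_pos T_pos by (intro mult_nonneg_nonneg) auto
  ultimately have "0 \<le> C"
    unfolding C_def by (intro add_nonneg_nonneg mult_nonneg_nonneg) auto
  show "\<exists>\<delta>>0. \<forall>p'\<in>cont_from T 0. d_inf p p' < \<delta> \<longrightarrow> \<bar>V p' - V p\<bar> < e"
  proof (intro exI[of _ "min 1 (e / (C + 1))"] conjI ballI impI)
    fix p' :: "'d path"
    assume p': "p' \<in> cont_from T 0" and d: "d_inf p p' < min 1 (e / (C + 1))"
    have p'0: "0 \<le> fst p'"
      using cont_fromD(1)[OF p'] .
    have D0: "0 \<le> d_inf p p'"
      using cont_fromD[OF p] cont_fromD[OF p'] by (intro d_inf_nonneg)
    have "norm (snd p' r) \<le> M" if r: "r \<in> {0..fst p'}" for r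
    proof -
      have "norm (snd p (min r (fst p)) - snd p' r) \<le> 1"
      proof -
        have "\<bar>fst p - fst p'\<bar> + norm (snd p (min r (fst p)) - snd p' (min r (fst p'))) \<le> d_inf p p'"
          using r by (intro d_inf_ge cont_fromD(5)[OF p] cont_fromD(5)[OF p'] p0 p'0) auto
        moreover have "min r (fst p') = r"
          using r by simp
        ultimately show ?thesis
          using d by linarith
      qed
      moreover have "norm (snd p (min r (fst p))) \<le> sup_norm p"
        using r p0 by (intro norm_le_sup_norm[OF cont_fromD(5)[OF p]]) auto
      ultimately show ?thesis
        unfolding M_def by (smt (verit) norm_minus_commute norm_triangle_sub)
    qed
    then have "sup_norm p' \<le> M"
      using p'0 by (intro sup_norm_le)
    then have "\<bar>V p' - V p\<bar> \<le> C * d_inf p p'"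
      using value_d_inf_lipschitz[OF p p', of M] value_d_inf_lipschitz[OF p' p, of M]
      unfolding C_def K_def
      by (cases "fst p \<le> fst p'") (auto simp: M_def abs_minus_commute d_inf_commute)
    also have "\<dots> \<le> (C + 1) * d_inf p p'"
      using D0 by (intro mult_right_mono) auto
    also have "\<dots> < e"
      using d \<open>0 \<le> C\<close> by (simp add: field_simps)
    finally show "\<bar>V p' - V p\<bar> < e" .
  qed (use \<open>e > 0\<close> \<open>0 \<le> C\<close> in auto)
qed

end

section \<open>First-order expansion of smooth functionals\<close>

lemma cadlag_atI:
  assumes "fst p = t" "snd p \<in> extensional {0..t}"
    "\<And>s. 0 \<le> s \<Longrightarrow> s < t \<Longrightarrow> (snd p \<longlongrightarrow> snd p s) (at_right s)"
    "\<And>s. 0 < s \<Longrightarrow> s \<le> t \<Longrightarrow> \<exists>l. (snd p \<longlongrightarrow> l) (at_left s)"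
  shows "p \<in> cadlag_at t"
  using assms unfolding cadlag_at_def by (auto intro!: exI[of _ "snd p"] simp: prod_eq_iff)

lemma cadlag_atD:
  assumes "p \<in> cadlag_at t"
  shows "fst p = t" "snd p \<in> extensional {0..t}"
    "\<And>s. 0 \<le> s \<Longrightarrow> s < t \<Longrightarrow> (snd p \<longlongrightarrow> snd p s) (at_right s)"
    "\<And>s. 0 < s \<Longrightarrow> s \<le> t \<Longrightarrow> \<exists>l. (snd p \<longlongrightarrow> l) (at_left s)"
  using assms unfolding cadlag_at_def by auto

lemma cadlag_at_cadlag_from:
  assumes "p \<in> cadlag_at s" "t \<le> s" "s \<le> T"
  shows "p \<in> cadlag_from T t"
  using assms by (auto simp: cadlag_from_def)

lemma cont_at_cadlag_at:
  assumes "p \<in> cont_at t"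
  shows "p \<in> cadlag_at t"
proof (rule cadlag_atI)
  note c = cont_atD(3)[OF assms]
  show "(snd p \<longlongrightarrow> snd p s) (at_right s)" if "0 \<le> s" "s < t" for s
    using that by (intro continuous_on_Icc_at_rightD[of s t] continuous_on_subset[OF c]) auto
  show "\<exists>l. (snd p \<longlongrightarrow> l) (at_left s)" if "0 < s" "s \<le> t" for s
    using that by (intro exI[of _ "snd p s"] continuous_on_Icc_at_leftD[of 0 s] continuous_on_subset[OF c]) auto
qed (use cont_atD[OF assms] in auto)

lemma snd_freeze: "snd (freeze p s) r = (if r \<in> {0..s} then snd p (min r (fst p)) else undefined)"
  by (auto simp: freeze_def path_upto_def)

text \<open>Before \<open>t\<close> the one-sided limits are those of \<open>p\<close>. From
  \<open>t\<close> on the path is constant, and its value at \<open>t\<close> is unchanged, so right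
  continuity holds at the junction too.\<close>

lemma freeze_cadlag_at:
  assumes p: "p \<in> cadlag_at t" and "0 \<le> t" "t \<le> s"
  shows "freeze p s \<in> cadlag_at s"
proof (rule cadlag_atI)
  have t: "fst p = t"
    using cadlag_atD(1)[OF p] .
  show "snd (freeze p s) \<in> extensional {0..s}"
    by (simp add: freeze_def path_upto_def)
  show "(snd (freeze p s) \<longlongrightarrow> snd (freeze p s) r) (at_right r)" if r: "0 \<le> r" "r < s" for r
  proof (cases "r < t")
    case True
    have "\<forall>\<^sub>F x in at_right r. snd p x = snd (freeze p s) x"
      using True r assms by (intro eventually_at_rightI[of r t]) (auto simp: snd_freeze t)
    moreover have "snd (freeze p s) r = snd p r"
      using True r t by (simp add: snd_freeze)
    ultimately show ?thesis
      using Lim_transform_eventually[OF cadlag_atD(3)[OF p r(1) True]] by simp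
  next
    case False
    have "\<forall>\<^sub>F x in at_right r. snd p t = snd (freeze p s) x"
      using False r assms by (intro eventually_at_rightI[of r s]) (auto simp: snd_freeze t min_def)
    moreover have "snd (freeze p s) r = snd p t"
      using False r t by (simp add: snd_freeze min_def)
    ultimately show ?thesis
      using Lim_transform_eventually[OF tendsto_const] by simp
  qed
  show "\<exists>l. (snd (freeze p s) \<longlongrightarrow> l) (at_left r)" if r: "0 < r" "r \<le> s" for r
  proof (cases "r \<le> t")
    case True
    have "\<forall>\<^sub>F x in at_left r. snd p x = snd (freeze p s) x"
      using True r assms by (intro eventually_at_leftI[of 0 r]) (auto simp: snd_freeze t)
    then show ?thesis
      using Lim_transform_eventually cadlag_atD(4)[OF p r(1) True] by blast
  next
    case False
    have "\<forall>\<^sub>F x in at_left r. snd p t = snd (freeze p s) x"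
      using False r assms by (intro eventually_at_leftI[of t r]) (auto simp: snd_freeze t min_def)
    then show ?thesis
      using Lim_transform_eventually tendsto_const by blast
  qed
qed simp

text \<open>Only the end value changes: no right limit is demanded at \<open>t\<close>, and the left
  limit there does not see the value at \<open>t\<close>.\<close>

lemma bump_cadlag_at:
  assumes p: "p \<in> cadlag_at t" and "0 \<le> t"
  shows "bump p x \<in> cadlag_at t"
proof (rule cadlag_atI)
  have t: "fst p = t"
    using cadlag_atD(1)[OF p] .
  then show "fst (bump p x) = t"
    by (simp add: bump_def)
  show "snd (bump p x) \<in> extensional {0..t}"
    using cadlag_atD(2)[OF p] \<open>0 \<le> t\<close> by (auto simp: bump_def extensional_def t)
  show "(snd (bump p x) \<longlongrightarrow> snd (bump p x) r) (at_right r)" if r: "0 \<le> r" "r < t" for r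
  proof -
    have "\<forall>\<^sub>F y in at_right r. snd p y = snd (bump p x) y"
      using r by (intro eventually_at_rightI[of r t]) (auto simp: bump_def t)
    moreover have "snd (bump p x) r = snd p r"
      using r by (simp add: bump_def t)
    ultimately show ?thesis
      using Lim_transform_eventually[OF cadlag_atD(3)[OF p r]] by simp
  qed
  show "\<exists>l. (snd (bump p x) \<longlongrightarrow> l) (at_left r)" if r: "0 < r" "r \<le> t" for r
  proof -
    have "\<forall>\<^sub>F y in at_left r. snd p y = snd (bump p x) y"
      using r by (intro eventually_at_leftI[of 0 r]) (auto simp: bump_def t)
    then show ?thesis
      using Lim_transform_eventually cadlag_atD(4)[OF p r] by blast
  qed
qed

lemma bump_zero: "bump p 0 = p"
  by (simp add: bump_def)

lemma bump_bump: "bump (bump p x) y = bump p (x + y)"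
  by (simp add: bump_def add.assoc)

lemma freeze_id:
  assumes "p \<in> cadlag_at t"
  shows "freeze p t = p"
proof -
  have "snd (freeze p t) = snd p"
    using cadlag_atD(1,2)[OF assms]
    by (intro extensionalityI[of _ "{0..t}"]) (auto simp: snd_freeze extensional_def)
  then show ?thesis
    using cadlag_atD(1)[OF assms] by (simp add: prod_eq_iff)
qed

lemma freeze_freeze:
  assumes "0 \<le> r" "r \<le> s" "fst p \<le> r"
  shows "freeze (freeze p r) s = freeze p s"
  using assms by (auto simp: prod_eq_iff fun_eq_iff snd_freeze min_def)

lemma d_inf_continuous_onD:
  assumes "d_inf_continuous_on S f" "p \<in> S" "0 < e"
  obtains \<delta> where "0 < \<delta>" "\<And>q. q \<in> S \<Longrightarrow> d_inf p q < \<delta> \<Longrightarrow> \<bar>f q - f p\<bar> < e"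
  using assms unfolding d_inf_continuous_on_def by meson

section \<open>Mean value estimates in the horizontal and vertical directions\<close>

lemma C1_horizontal:
  assumes g: "g \<in> C1_cadlag T t" and p: "p \<in> cadlag_from T t" "fst p < T"
  shows "has_horizontal_deriv g p (time_deriv T g p)"
proof -
  obtain D where D: "has_time_deriv T g p D"
    using g p by (auto simp: C1_cadlag_def)
  have "time_deriv T g p = D"
    unfolding time_deriv_def
  proof (rule the_equality)
    fix E assume "has_time_deriv T g p E"
    then show "E = D"
      using D p(2) tendsto_unique[OF trivial_limit_at_right_real]
      unfolding has_time_deriv_def has_horizontal_deriv_def by auto
  qed (rule D)
  then show ?thesis
    using D p(2) by (simp add: has_time_deriv_def)
qed

lemma C1_vertical:
  assumes g: "g \<in> C1_cadlag T t" and p: "p \<in> cadlag_from T t"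
  shows "has_space_deriv g i p (space_deriv g i p)"
proof -
  obtain D where D: "has_space_deriv g i p D"
    using g p unfolding C1_cadlag_def by blast
  have "space_deriv g i p = D"
    unfolding space_deriv_def
  proof (rule the_equality)
    fix E assume "has_space_deriv g i p E"
    then show "E = D"
      using D tendsto_unique[of "at (0::real)"]
      unfolding has_space_deriv_def by auto
  qed (rule D)
  then show ?thesis
    using D by simp
qed

text \<open>If the chord were steeper than \<open>c\<close>, take a slope \<open>c'\<close> strictly
  between \<open>c\<close> and the chord slope. At the last point where \<open>f\<close> lies on or
  below the line of slope \<open>c'\<close> through \<open>(a, f a)\<close>, the right derivative is
  at most \<open>c < c'\<close>, so \<open>f\<close> stays below that line a little longer, a
  contradiction. One-sided derivatives suffice for this argument, and a horizontal derivative gives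
  no more.\<close>

lemma increment_le_right_deriv:
  fixes f :: "real \<Rightarrow> real"
  assumes "a \<le> b" and f: "continuous_on {a..b} f"
    and D: "\<And>x. a \<le> x \<Longrightarrow> x < b \<Longrightarrow> \<exists>D\<le>c. ((\<lambda>h. (f (x + h) - f x) / h) \<longlongrightarrow> D) (at_right 0)"
  shows "f b - f a \<le> c * (b - a)"
proof (rule ccontr)
  assume less: "\<not> f b - f a \<le> c * (b - a)"
  then have ab: "a < b"
    using \<open>a \<le> b\<close> by (cases "a = b") auto
  define m where "m = (f b - f a) / (b - a)"
  define c' where "c' = (c + m) / 2"
  have "c < m"
    using less ab by (simp add: m_def field_simps)
  then have c': "c < c'" "c' < m"
    by (auto simp: c'_def)
  define w where "w = (\<lambda>x. f x - f a - c' * (x - a))"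
  have w: "continuous_on {a..b} w"
    unfolding w_def by (intro continuous_intros f)
  have "w b = (m - c') * (b - a)"
    using ab by (simp add: w_def m_def field_simps)
  then have wb: "0 < w b"
    using c' ab by simp
  have "closed {x \<in> {a..b}. w x \<in> {..0}}"
    by (intro continuous_closed_preimage[OF w, unfolded vimage_def Int_def, simplified mem_Collect_eq]) auto
  then have "compact {x \<in> {a..b}. w x \<in> {..0}}"
    by (rule compact_Int_closed[OF compact_Icc[of a b], THEN back_subst[of compact]]) auto
  moreover have "a \<in> {x \<in> {a..b}. w x \<in> {..0}}"
    using ab by (simp add: w_def)
  ultimately obtain x where x: "x \<in> {a..b}" "w x \<le> 0"
    and max: "\<And>y. y \<in> {a..b} \<Longrightarrow> w y \<le> 0 \<Longrightarrow> y \<le> x"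
    using compact_attains_sup[of "{x \<in> {a..b}. w x \<in> {..0}}"] by auto
  have xb: "x < b"
    using x wb by (cases "x = b") auto
  obtain D where "D \<le> c" and lim: "((\<lambda>h. (f (x + h) - f x) / h) \<longlongrightarrow> D) (at_right 0)"
    using D[of x] x xb by auto
  then have "\<forall>\<^sub>F h in at_right 0. (f (x + h) - f x) / h < c'"
    using c' by (intro order_tendstoD(2)[OF lim]) auto
  moreover have "\<forall>\<^sub>F h in at_right 0. 0 < h \<and> h < b - x"
    using xb by (intro eventually_at_rightI[of 0 "b - x"]) auto
  ultimately have "\<forall>\<^sub>F h in at_right 0. (f (x + h) - f x) / h < c' \<and> 0 < h \<and> h < b - x"
    by eventually_elim auto
  then obtain h where h: "(f (x + h) - f x) / h < c'" "0 < h" "h < b - x"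
    using eventually_happens'[OF trivial_limit_at_right_real] by blast
  then have "w (x + h) < w x"
    by (simp add: w_def field_simps)
  then show False
    using max[of "x + h"] x h by auto
qed

lemma increment_right_deriv:
  fixes f :: "real \<Rightarrow> real"
  assumes "a \<le> b" and f: "continuous_on {a..b} f"
    and D: "\<And>x. a \<le> x \<Longrightarrow> x < b \<Longrightarrow> \<exists>D. \<bar>D - c\<bar> \<le> e \<and> ((\<lambda>h. (f (x + h) - f x) / h) \<longlongrightarrow> D) (at_right 0)"
  shows "\<bar>f b - f a - c * (b - a)\<bar> \<le> e * (b - a)"
proof -
  have "f b - f a \<le> (c + e) * (b - a)"
  proof (rule increment_le_right_deriv[OF \<open>a \<le> b\<close> f])
    fix x assume "a \<le> x" "x < b"
    then obtain D where "\<bar>D - c\<bar> \<le> e" "((\<lambda>h. (f (x + h) - f x) / h) \<longlongrightarrow> D) (at_right 0)"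
      using D by blast
    then show "\<exists>D\<le>c + e. ((\<lambda>h. (f (x + h) - f x) / h) \<longlongrightarrow> D) (at_right 0)"
      by (intro exI[of _ D]) auto
  qed
  moreover have "(- f b) - (- f a) \<le> (e - c) * (b - a)"
  proof (rule increment_le_right_deriv[OF \<open>a \<le> b\<close>])
    fix x assume "a \<le> x" "x < b"
    then obtain D where "\<bar>D - c\<bar> \<le> e" and D: "((\<lambda>h. (f (x + h) - f x) / h) \<longlongrightarrow> D) (at_right 0)"
      using D by blast
    moreover have "(\<lambda>h. (- f (x + h) - - f x) / h) = (\<lambda>h. - ((f (x + h) - f x) / h))"
      by (auto simp: fun_eq_iff diff_divide_distrib)
    ultimately show "\<exists>D\<le>e - c. ((\<lambda>h. (- f (x + h) - - f x) / h) \<longlongrightarrow> D) (at_right 0)"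
      using tendsto_minus[OF D] by (intro exI[of _ "- D"]) auto
  qed (intro continuous_intros f)
  ultimately show ?thesis
    by (simp add: abs_le_iff algebra_simps)
qed

lemma horizontal_increment:
  assumes g: "g \<in> C1_cadlag T t" and p: "p \<in> cadlag_at s" and s: "0 \<le> t" "t \<le> s" "s \<le> s'" "s' < T"
    and near: "\<And>r. s \<le> r \<Longrightarrow> r \<le> s' \<Longrightarrow> \<bar>time_deriv T g (freeze p r) - a\<bar> \<le> e"
  shows "\<bar>g (freeze p s') - g p - a * (s' - s)\<bar> \<le> e * (s' - s)"
proof -
  have fst: "fst p = s"
    using cadlag_atD(1)[OF p] .
  have fr: "freeze p r \<in> cadlag_from T t" if "s \<le> r" "r \<le> s'" for r
    using that s by (intro cadlag_at_cadlag_from[OF freeze_cadlag_at[OF p]]) auto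
  have "\<bar>g (freeze p s') - g (freeze p s) - a * (s' - s)\<bar> \<le> e * (s' - s)"
  proof (rule increment_right_deriv[OF s(3)])
    show "continuous_on {s..s'} (\<lambda>r. g (freeze p r))"
      unfolding continuous_on_iff
    proof safe
      fix r e :: real assume r: "r \<in> {s..s'}" and "0 < e"
      then have fr_r: "freeze p r \<in> cadlag_from T t"
        by (intro fr) auto
      have "d_inf_continuous_on (cadlag_from T t) g"
        using g by (simp add: C1_cadlag_def)
      then obtain \<delta> where \<delta>: "0 < \<delta>"
        "\<And>q. q \<in> cadlag_from T t \<Longrightarrow> d_inf (freeze p r) q < \<delta> \<Longrightarrow> \<bar>g q - g (freeze p r)\<bar> < e"
        using d_inf_continuous_onD fr_r \<open>0 < e\<close> by blast
      show "\<exists>d>0. \<forall>r'\<in>{s..s'}. dist r' r < d \<longrightarrow> dist (g (freeze p r')) (g (freeze p r)) < e"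
      proof (intro exI[of _ \<delta>] conjI ballI impI \<delta>(1))
        fix r' assume r': "r' \<in> {s..s'}" "dist r' r < \<delta>"
        have "d_inf (freeze p r) (freeze p r') \<le> \<bar>fst (freeze p r) - fst (freeze p r')\<bar> + 0"
          using r r' s by (intro d_inf_le) (auto simp: snd_freeze fst min_def)
        then have "d_inf (freeze p r) (freeze p r') < \<delta>"
          using r' by (simp add: dist_real_def abs_minus_commute)
        then show "dist (g (freeze p r')) (g (freeze p r)) < e"
          using \<delta>(2)[OF fr] r' by (simp add: dist_real_def)
      qed
    qed
    fix r assume r: "s \<le> r" "r < s'"
    have "has_horizontal_deriv g (freeze p r) (time_deriv T g (freeze p r))"
      using r s by (intro C1_horizontal[OF g fr]) auto
    then have "((\<lambda>h. (g (freeze (freeze p r) (r + h)) - g (freeze p r)) / h) \<longlongrightarrow> time_deriv T g (freeze p r)) (at_right 0)"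
      by (simp add: has_horizontal_deriv_def)
    moreover have "\<forall>\<^sub>F h in at_right 0. (g (freeze (freeze p r) (r + h)) - g (freeze p r)) / h
        = (g (freeze p (r + h)) - g (freeze p r)) / h"
      using r s by (intro eventually_at_rightI[of 0 1]) (auto simp: freeze_freeze fst)
    ultimately have "((\<lambda>h. (g (freeze p (r + h)) - g (freeze p r)) / h) \<longlongrightarrow> time_deriv T g (freeze p r)) (at_right 0)"
      by (rule Lim_transform_eventually)
    then show "\<exists>D. \<bar>D - a\<bar> \<le> e \<and> ((\<lambda>h. (g (freeze p (r + h)) - g (freeze p r)) / h) \<longlongrightarrow> D) (at_right 0)"
      using near[of r] r by auto
  qed
  then show ?thesis
    by (simp add: freeze_id[OF p])
qed

text \<open>Vertical derivatives are two-sided, so the classical mean value inequality applies after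
  subtracting the linear function of slope \<open>c\<close>.\<close>

lemma coordinate_increment:
  assumes g: "g \<in> C1_cadlag T t" and p: "p \<in> cadlag_at s" and s: "0 \<le> t" "t \<le> s" "s \<le> T"
    and near: "\<And>h. \<bar>h\<bar> \<le> \<bar>x\<bar> \<Longrightarrow> \<bar>space_deriv g i (bump p (h *\<^sub>R axis i 1)) - c\<bar> \<le> e"
  shows "\<bar>g (bump p (x *\<^sub>R axis i 1)) - g p - c * x\<bar> \<le> e * \<bar>x\<bar>"
proof -
  define f where "f = (\<lambda>h. g (bump p (h *\<^sub>R axis i 1)) - c * h)"
  have "norm (f x - f 0) \<le> e * norm (x - 0)"
  proof (rule field_differentiable_bound)
    show "convex (closed_segment 0 x)"
      by simp
    fix h assume h: "h \<in> closed_segment 0 x"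
    have "bump p (h *\<^sub>R axis i 1) \<in> cadlag_from T t"
      using s by (intro cadlag_at_cadlag_from[OF bump_cadlag_at[OF p]]) auto
    \<comment> \<open>Two jumps at the end add up, so the vertical derivative at the bumped path is
      the ordinary derivative of the one-variable function at \<open>h\<close>.\<close>
    from C1_vertical[OF g this, of i]
    have "((\<lambda>h. g (bump p (h *\<^sub>R axis i 1))) has_field_derivative
        space_deriv g i (bump p (h *\<^sub>R axis i 1))) (at h)"
      unfolding has_space_deriv_def DERIV_def bump_bump by (simp add: scaleR_add_left)
    then show "(f has_field_derivative (space_deriv g i (bump p (h *\<^sub>R axis i 1)) - c)) (at h within closed_segment 0 x)"
      unfolding f_def by (auto intro!: derivative_eq_intros intro: DERIV_subset)
    have "\<bar>h\<bar> \<le> \<bar>x\<bar>"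
      using h by (auto simp: closed_segment_eq_real_ivl split: if_splits)
    then show "norm (space_deriv g i (bump p (h *\<^sub>R axis i 1)) - c) \<le> e"
      using near by simp
  qed auto
  then show ?thesis
    by (simp add: f_def bump_zero algebra_simps)
qed

text \<open>Partial derivatives control one coordinate at a time, so the jump is built up coordinate
  by coordinate. Every intermediate jump has norm at most \<open>norm x\<close>, hence stays where
  \<open>near\<close> applies. The factor \<open>CARD('d)\<close> comes from replacing each
  coordinate by \<open>norm x\<close>.\<close>

lemma vertical_increment:
  fixes p :: "('d::finite) path" and x :: "real^'d"
  assumes g: "g \<in> C1_cadlag T t" and p: "p \<in> cadlag_at s" and s: "0 \<le> t" "t \<le> s" "s \<le> T"
    and near: "\<And>y i. norm y \<le> norm x \<Longrightarrow> \<bar>space_deriv g i (bump p y) - b $ i\<bar> \<le> e"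
  shows "\<bar>g (bump p x) - g p - b \<bullet> x\<bar> \<le> e * (CARD('d) * norm x)"
proof -
  \<comment> \<open>The part of the jump already made: the coordinates of \<open>x\<close> in
    \<open>I\<close>, and 0 elsewhere.\<close>
  define y where "y = (\<lambda>I. \<chi> i. if i \<in> I then x $ i else 0)"
  have "\<bar>g (bump p (y I)) - g p - (\<Sum>i\<in>I. b $ i * x $ i)\<bar> \<le> e * (\<Sum>i\<in>I. \<bar>x $ i\<bar>)" for I
  proof (induction I rule: finite_induct[OF finite])
    case 1
    have "y {} = 0"
      by (simp add: y_def vec_eq_iff)
    then show ?case
      by (simp add: bump_zero)
  next
    case (2 j I)
    have y: "y (insert j I) = y I + (x $ j) *\<^sub>R axis j 1"
      using 2 by (auto simp: y_def vec_eq_iff axis_def)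
    have "\<bar>g (bump (bump p (y I)) ((x $ j) *\<^sub>R axis j 1)) - g (bump p (y I)) - b $ j * x $ j\<bar> \<le> e * \<bar>x $ j\<bar>"
    proof (rule coordinate_increment[OF g bump_cadlag_at[OF p] s])
      fix h :: real assume h: "\<bar>h\<bar> \<le> \<bar>x $ j\<bar>"
      have "norm (y I + h *\<^sub>R axis j 1) \<le> norm x"
        using h 2 by (intro norm_le_componentwise_cart) (auto simp: y_def axis_def)
      then show "\<bar>space_deriv g j (bump (bump p (y I)) (h *\<^sub>R axis j 1)) - b $ j\<bar> \<le> e"
        unfolding bump_bump by (rule near)
    qed (use s in auto)
    with 2 show ?case
      by (simp add: y bump_bump algebra_simps)
  qed
  from this[of UNIV] have "\<bar>g (bump p x) - g p - b \<bullet> x\<bar> \<le> e * (\<Sum>i\<in>UNIV. \<bar>x $ i\<bar>)"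
    by (simp add: y_def inner_vec_def)
  also have "\<dots> \<le> e * (\<Sum>i\<in>(UNIV::'d set). norm x)"
    using near[of 0 undefined] by (intro mult_left_mono sum_mono component_le_norm_cart) auto
  finally show ?thesis
    by simp
qed

text \<open>A Lipschitz path is approximated by cadlag step functions: each step is a horizontal
  extension followed by a vertical jump, along which the functional has classical derivatives.\<close>

lemma step_approximation:
  fixes p :: "('d::finite) path" and h K a e :: real
  assumes g: "g \<in> C1_cadlag T t" and p: "p \<in> cont_at t" and t: "0 \<le> t" "t + h < T" "0 \<le> h" and K: "0 \<le> K"
    and X: "\<And>r. r \<in> {0..t} \<Longrightarrow> X r = snd p r"
    and lip: "\<And>r r'. t \<le> r \<Longrightarrow> r \<le> r' \<Longrightarrow> r' \<le> t + h \<Longrightarrow> norm (X r' - X r) \<le> K * (r' - r)"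
    and near: "\<And>q. q \<in> cadlag_from T t \<Longrightarrow> fst q \<le> t + h \<Longrightarrow>
      (\<And>r. r \<in> {0..fst q} \<Longrightarrow> norm (snd q r - snd p (min r t)) \<le> 2 * K * h) \<Longrightarrow>
      \<bar>time_deriv T g q - a\<bar> \<le> e \<and> (\<forall>i. \<bar>space_deriv g i q - b $ i\<bar> \<le> e)"
    and n: "0 < n"
  shows "\<exists>Q\<in>cadlag_at (t + h). (\<forall>r\<in>{0..t + h}. norm (snd Q r - X r) \<le> K * (h / real n))
    \<and> \<bar>g Q - g p - a * h - b \<bullet> (X (t + h) - X t)\<bar> \<le> e * (1 + CARD('d) * K) * h"
proof -
  define \<Delta> where "\<Delta> = h / real n"
  define \<tau> where "\<tau> = (\<lambda>i::nat. t + real i * \<Delta>)"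
  have \<Delta>: "0 \<le> \<Delta>"
    using t by (simp add: \<Delta>_def)
  have n\<Delta>: "real n * \<Delta> = h"
    using n by (simp add: \<Delta>_def)
  have \<tau>_le: "\<tau> i \<le> t + h" if "i \<le> n" for i
    using that \<Delta> n\<Delta> mult_right_mono[of "real i" "real n" \<Delta>] by (simp add: \<tau>_def)
  have \<tau>_ge: "t \<le> \<tau> i" for i
    using \<Delta> by (simp add: \<tau>_def)
  have \<tau>_Suc: "\<tau> (Suc i) = \<tau> i + \<Delta>" for i
    by (simp add: \<tau>_def algebra_simps)
  have dev: "norm (X r' - snd p (min r t)) \<le> K * h"
    if "0 \<le> r" "min r t \<le> r'" "r' \<le> r" "r \<le> t + h" for r r'
  proof -
    have "norm (X r' - X (min r t)) \<le> K * h"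
    proof (cases "r \<le> t")
      case True
      then show ?thesis
        using that K t by simp
    next
      case False
      then have "norm (X r' - X (min r t)) \<le> K * (r' - t)"
        using that by (auto intro!: lip)
      also have "\<dots> \<le> K * h"
        using that K by (intro mult_left_mono) auto
      finally show ?thesis .
    qed
    then show ?thesis
      using X[of "min r t"] that t by simp
  qed
  \<comment> \<open>Every value of \<open>Q\<close> is a value of \<open>X\<close> delayed by at
    most \<open>\<Delta>\<close>. The clause \<open>min r t \<le> r'\<close> makes \<open>Q\<close>
    exact on [0,t] and prevents the delay from reaching back before \<open>t\<close> afterwards. The
    end value is exact, ready for the next freezing.\<close>
  have "\<exists>Q\<in>cadlag_at (\<tau> i). snd Q (\<tau> i) = X (\<tau> i)
      \<and> (\<forall>r\<in>{0..\<tau> i}. \<exists>r'. snd Q r = X r' \<and> r' \<le> r \<and> r - r' \<le> \<Delta> \<and> min r t \<le> r')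
      \<and> \<bar>g Q - g p - a * (\<tau> i - t) - b \<bullet> (X (\<tau> i) - X t)\<bar> \<le> e * (1 + CARD('d) * K) * (\<tau> i - t)"
    if "i \<le> n" for i
    using that
  proof (induction i)
    case 0
    have "\<tau> 0 = t"
      by (simp add: \<tau>_def)
    then show ?case
      using \<Delta> X t cont_at_cadlag_at[OF p]
      by (intro bexI[of _ p]) force+
  next
    case (Suc i)
    then obtain Q where Q: "Q \<in> cadlag_at (\<tau> i)" and end_Q: "snd Q (\<tau> i) = X (\<tau> i)"
      and Q_X: "\<And>r. r \<in> {0..\<tau> i} \<Longrightarrow> \<exists>r'. snd Q r = X r' \<and> r' \<le> r \<and> r - r' \<le> \<Delta> \<and> min r t \<le> r'"
      and g_Q: "\<bar>g Q - g p - a * (\<tau> i - t) - b \<bullet> (X (\<tau> i) - X t)\<bar> \<le> e * (1 + CARD('d) * K) * (\<tau> i - t)"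
      by auto
    let ?s = "\<tau> i" and ?s' = "\<tau> (Suc i)"
    have s: "t \<le> ?s" "?s \<le> ?s'" "?s' \<le> t + h" "?s' = ?s + \<Delta>"
      using \<tau>_ge[of i] \<tau>_le[OF Suc.prems] \<Delta> by (auto simp: \<tau>_Suc)
    have fst_Q: "fst Q = ?s"
      using cadlag_atD(1)[OF Q] .
    define x where "x = X ?s' - X ?s"
    have x: "norm x \<le> K * \<Delta>"
      using lip[of ?s ?s'] s by (simp add: x_def)
    have "K * \<Delta> \<le> K * h"
      using s K by (intro mult_left_mono) auto
    with x have x_h: "norm x \<le> K * h"
      by simp
    have Q_dev: "norm (snd Q (min r ?s) - snd p (min r t)) \<le> K * h" if r: "0 \<le> r" "r \<le> ?s'" for r
    proof -
      obtain r' where r': "snd Q (min r ?s) = X r'" "r' \<le> min r ?s" "min (min r ?s) t \<le> r'"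
        using Q_X[of "min r ?s"] r s t by auto
      then show ?thesis
        using dev[of r r'] r s by (auto simp: min_def split: if_splits)
    qed
    have freeze_near: "\<bar>time_deriv T g (freeze Q r) - a\<bar> \<le> e" if r: "?s \<le> r" "r \<le> ?s'" for r
    proof -
      have "freeze Q r \<in> cadlag_from T t"
        using r s t by (intro cadlag_at_cadlag_from[OF freeze_cadlag_at[OF Q]]) auto
      moreover have "norm (snd (freeze Q r) r' - snd p (min r' t)) \<le> 2 * K * h" if "r' \<in> {0..r}" for r'
        using Q_dev[of r'] that r mult_nonneg_nonneg[OF K t(3)] by (simp add: fst_Q)
      ultimately show ?thesis
        using near[of "freeze Q r"] r s by simp
    qed
    \<comment> \<open>One step: freeze at the old end value, then jump by the increment
      \<open>x\<close> of \<open>X\<close>, so that the new end value is again that of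
      \<open>X\<close>.\<close>
    define R where "R = freeze Q ?s'"
    have R: "R \<in> cadlag_at ?s'"
      unfolding R_def using s t by (intro freeze_cadlag_at[OF Q]) auto
    have snd_R: "snd R r = snd Q (min r ?s)" if "r \<in> {0..?s'}" for r
      using that by (simp add: R_def fst_Q)
    have fst_R: "fst R = ?s'"
      by (simp add: R_def)
    have bump_near: "\<bar>space_deriv g j (bump R y) - b $ j\<bar> \<le> e" if y: "norm y \<le> norm x" for y j
    proof -
      have "bump R y \<in> cadlag_from T t"
        using s t by (intro cadlag_at_cadlag_from[OF bump_cadlag_at[OF R]]) auto
      \<comment> \<open>One \<open>K * h\<close> is the deviation of the step path from
        \<open>p\<close> frozen, the other the incomplete jump \<open>y\<close>; this is the origin
        of \<open>2 * K * h\<close> in \<open>near\<close>.\<close>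
      moreover have "norm (snd (bump R y) r - snd p (min r t)) \<le> 2 * K * h" if r: "r \<in> {0..?s'}" for r
      proof -
        have 1: "norm (snd R r - snd p (min r t)) \<le> K * h"
          using Q_dev[of r] r snd_R[OF r] by simp
        have "norm ((snd R r - snd p (min r t)) + y) \<le> K * h + K * h"
          using 1 y x_h by (intro norm_triangle_mono) auto
        then show ?thesis
          using 1 mult_nonneg_nonneg[OF K t(3)] by (auto simp: bump_def algebra_simps)
      qed
      ultimately show ?thesis
        using near[of "bump R y"] s by (simp add: fst_R bump_def)
    qed
    have hor: "\<bar>g R - g Q - a * \<Delta>\<bar> \<le> e * \<Delta>"
      using horizontal_increment[OF g Q t(1) s(1,2) _ freeze_near] s t by (simp add: R_def)
    have "\<bar>g (bump R x) - g R - b \<bullet> x\<bar> \<le> e * (CARD('d) * norm x)"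
      using s t by (intro vertical_increment[OF g R] bump_near) auto
    also have "\<dots> \<le> e * (CARD('d) * (K * \<Delta>))"
      using x bump_near[of 0 undefined] by (intro mult_left_mono) auto
    finally have vert: "\<bar>g (bump R x) - g R - b \<bullet> x\<bar> \<le> e * (CARD('d) * (K * \<Delta>))" .
    have sum: "g (bump R x) - g p - a * (?s' - t) - b \<bullet> (X ?s' - X t)
        = (g (bump R x) - g R - b \<bullet> x) + (g R - g Q - a * \<Delta>) + (g Q - g p - a * (?s - t) - b \<bullet> (X ?s - X t))"
      by (simp add: s(4) x_def inner_diff_right algebra_simps)
    \<comment> \<open>A step contributes \<open>e * \<Delta>\<close> horizontally and
      \<open>e * CARD('d) * K * \<Delta>\<close> vertically. The errors add up in proportion to
      elapsed time, independently of the number of steps.\<close>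
    have "\<bar>g (bump R x) - g p - a * (?s' - t) - b \<bullet> (X ?s' - X t)\<bar>
        \<le> e * (CARD('d) * (K * \<Delta>)) + e * \<Delta> + e * (1 + CARD('d) * K) * (?s - t)"
      unfolding sum using hor vert g_Q by linarith
    also have "\<dots> = e * (1 + CARD('d) * K) * (?s' - t)"
      by (simp add: s(4) algebra_simps)
    finally have g_bump: "\<bar>g (bump R x) - g p - a * (?s' - t) - b \<bullet> (X ?s' - X t)\<bar> \<le> e * (1 + CARD('d) * K) * (?s' - t)" .
    have end_R: "snd (bump R x) ?s' = X ?s'"
      using snd_R[of ?s'] s t end_Q by (simp add: bump_def fst_R x_def min_def)
    have "\<exists>r'. snd (bump R x) r = X r' \<and> r' \<le> r \<and> r - r' \<le> \<Delta> \<and> min r t \<le> r'" if r: "r \<in> {0..?s'}" for r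
    proof (cases "r = ?s'")
      case True
      then show ?thesis
        using end_R \<Delta> by auto
    next
      case False
      then have eq: "snd (bump R x) r = snd Q (min r ?s)"
        using snd_R[OF r] by (simp add: bump_def fst_R)
      show ?thesis
      proof (cases "r \<le> ?s")
        case True
        then show ?thesis
          using Q_X[of r] r by (simp add: eq)
      next
        case False
        then show ?thesis
          using r s end_Q by (intro exI[of _ ?s]) (auto simp: eq min_def)
      qed
    qed
    then show ?case
      using end_R g_bump s t by (intro bexI[of _ "bump R x"] bump_cadlag_at[OF R]) auto
  qed
  from this[of n] have "\<exists>Q\<in>cadlag_at (t + h). (\<forall>r\<in>{0..t + h}. \<exists>r'. snd Q r = X r' \<and> r' \<le> r \<and> r - r' \<le> \<Delta> \<and> min r t \<le> r')
      \<and> \<bar>g Q - g p - a * h - b \<bullet> (X (t + h) - X t)\<bar> \<le> e * (1 + CARD('d) * K) * h"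
    by (auto simp: \<tau>_def n\<Delta>)
  moreover have "norm (X r' - X r) \<le> K * \<Delta>"
    if "r \<in> {0..t + h}" "r' \<le> r" "r - r' \<le> \<Delta>" "min r t \<le> r'" for r r'
  proof (cases "r \<le> t")
    case True
    then show ?thesis
      using that K \<Delta> by simp
  next
    case False
    then have "norm (X r - X r') \<le> K * (r - r')"
      using that by (intro lip) auto
    also have "\<dots> \<le> K * \<Delta>"
      using that K by (intro mult_left_mono) auto
    finally show ?thesis
      by (simp add: norm_minus_commute)
  qed
  ultimately show ?thesis
    unfolding \<Delta>_def[symmetric] by metis
qed

text \<open>For small \<open>h\<close> all step paths lie in a ball around \<open>p\<close> on which
  every derivative of \<open>g\<close> varies by at most \<open>e'\<close>. The radius \<eta>
  depends on \<open>p\<close>, \<open>K\<close> and \<open>e\<close> but not on \<open>X\<close>.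
  With \<open>h\<close> fixed the mesh is then refined, and continuity of \<open>g\<close> at the
  end path replaces the step path by \<open>X\<close>.\<close>

lemma taylor_along_lipschitz:
  fixes p :: "('d::finite) path" and K e :: real
  assumes g: "g \<in> C1_cadlag T t" and p: "p \<in> cont_at t" and t: "0 \<le> t" "t < T" and K: "0 \<le> K" and "0 < e"
  obtains \<eta> where "0 < \<eta>" "t + \<eta> < T"
    "\<And>X h. continuous_on {0..T} X \<Longrightarrow> (\<And>r. r \<in> {0..t} \<Longrightarrow> X r = snd p r) \<Longrightarrow> 0 \<le> h \<Longrightarrow> h \<le> \<eta> \<Longrightarrow>
      (\<And>r r'. t \<le> r \<Longrightarrow> r \<le> r' \<Longrightarrow> r' \<le> t + h \<Longrightarrow> norm (X r' - X r) \<le> K * (r' - r)) \<Longrightarrow>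
      \<bar>g (path_upto X (t + h)) - g p - time_deriv T g p * h - space_grad g p \<bullet> (X (t + h) - X t)\<bar> \<le> e * h"
proof -
  \<comment> \<open>Compensates the factor \<open>1 + CARD('d) * K\<close> in the error of
    \<open>step_approximation\<close>.\<close>
  define e' where "e' = e / (1 + CARD('d) * K)"
  have pos: "0 < 1 + CARD('d) * K"
    using K by (simp add: add_pos_nonneg)
  have e': "0 < e'" "e' * (1 + CARD('d) * K) = e"
    using pos \<open>0 < e\<close> by (auto simp: e'_def)
  have p_in: "p \<in> cadlag_from T t"
    using p t by (intro cadlag_at_cadlag_from[OF cont_at_cadlag_at]) auto
  have fst_p: "fst p = t"
    using cont_atD(1)[OF p] .
  have g_cont: "d_inf_continuous_on (cadlag_from T t) g"
    and dt_cont: "d_inf_continuous_on (cadlag_from T t) (time_deriv T g)"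
    and dx_cont: "\<And>i. d_inf_continuous_on (cadlag_from T t) (space_deriv g i)"
    using g by (auto simp: C1_cadlag_def)
  obtain \<delta>0 where \<delta>0: "0 < \<delta>0"
    "\<And>q. q \<in> cadlag_from T t \<Longrightarrow> d_inf p q < \<delta>0 \<Longrightarrow> \<bar>time_deriv T g q - time_deriv T g p\<bar> < e'"
    using d_inf_continuous_onD[OF dt_cont p_in e'(1)] by blast
  have "\<exists>\<delta>>0. \<forall>q\<in>cadlag_from T t. d_inf p q < \<delta> \<longrightarrow> \<bar>space_deriv g i q - space_deriv g i p\<bar> < e'" for i
    using dx_cont[of i] p_in e'(1) unfolding d_inf_continuous_on_def by blast
  then obtain \<delta>1 where \<delta>1: "\<And>i. 0 < \<delta>1 i"
    "\<And>i q. q \<in> cadlag_from T t \<Longrightarrow> d_inf p q < \<delta>1 i \<Longrightarrow> \<bar>space_deriv g i q - space_deriv g i p\<bar> < e'"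
    by metis
  \<comment> \<open>The minimum is positive because there are finitely many coordinates.\<close>
  define \<delta> where "\<delta> = Min (insert \<delta>0 (range \<delta>1))"
  have \<delta>: "0 < \<delta>" "\<delta> \<le> \<delta>0" "\<And>i. \<delta> \<le> \<delta>1 i"
    using \<delta>0(1) \<delta>1(1) unfolding \<delta>_def by (auto simp del: Min_insert intro: Min_le)
  \<comment> \<open>A step path is within \<open>h\<close> in time and \<open>2 * K * h\<close> in
    space of \<open>p\<close>, so its distance is at most \<open>h * (1 + 2 * K)\<close>; the extra
    2 makes the inequality strict. The second term keeps times below \<open>T\<close>.\<close>
  define \<eta> where "\<eta> = min (\<delta> / (2 * (1 + 2 * K))) ((T - t) / 2)"
  have \<eta>: "0 < \<eta>" "t + \<eta> < T"
    using \<delta> K t by (auto simp: \<eta>_def min_def field_simps)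
  have "\<eta> * (1 + 2 * K) \<le> \<delta> / (2 * (1 + 2 * K)) * (1 + 2 * K)"
    using K by (intro mult_right_mono) (auto simp: \<eta>_def)
  also have "\<dots> = \<delta> / 2"
    using K by (simp add: field_simps)
  finally have \<eta>_\<delta>: "\<eta> * (1 + 2 * K) < \<delta>"
    using \<delta> by simp
  show ?thesis
  proof (rule that[OF \<eta>])
    fix X h
    assume X: "continuous_on {0..T} X" and init: "\<And>r. r \<in> {0..t} \<Longrightarrow> X r = snd p r"
      and h: "0 \<le> h" "h \<le> \<eta>"
      and lip: "\<And>r r'. t \<le> r \<Longrightarrow> r \<le> r' \<Longrightarrow> r' \<le> t + h \<Longrightarrow> norm (X r' - X r) \<le> K * (r' - r)"
    have th: "t + h < T"
      using h \<eta> by simp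
    have near: "\<bar>time_deriv T g q - time_deriv T g p\<bar> \<le> e' \<and> (\<forall>i. \<bar>space_deriv g i q - space_grad g p $ i\<bar> \<le> e')"
      if q: "q \<in> cadlag_from T t" "fst q \<le> t + h"
        and dev: "\<And>r. r \<in> {0..fst q} \<Longrightarrow> norm (snd q r - snd p (min r t)) \<le> 2 * K * h" for q
    proof -
      have fst_q: "t \<le> fst q"
        using q(1) by (auto simp: cadlag_from_def cadlag_at_def)
      have "d_inf p q \<le> \<bar>fst p - fst q\<bar> + 2 * K * h"
        using fst_q fst_p t dev by (intro d_inf_le) (auto simp: norm_minus_commute max_def)
      also have "\<dots> \<le> h * (1 + 2 * K)"
        using fst_q q(2) by (simp add: fst_p algebra_simps)
      also have "\<dots> \<le> \<eta> * (1 + 2 * K)"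
        using h K by (intro mult_right_mono) auto
      finally have "d_inf p q < \<delta>"
        using \<eta>_\<delta> by simp
      then have "d_inf p q < \<delta>0" "d_inf p q < \<delta>1 i" for i
        using \<delta>(2) \<delta>(3)[of i] by auto
      then show ?thesis
        using \<delta>0(2)[OF q(1)] \<delta>1(2)[OF q(1)] by (simp add: space_grad_def less_imp_le)
    qed
    have Y: "path_upto X (t + h) \<in> cadlag_from T t"
      using cont_at_cadlag_at[OF path_upto_cont_at[OF X, of "t + h"]] th h
      by (intro cadlag_at_cadlag_from[of _ "t + h"]) auto
    show "\<bar>g (path_upto X (t + h)) - g p - time_deriv T g p * h - space_grad g p \<bullet> (X (t + h) - X t)\<bar> \<le> e * h"
    proof (rule field_le_epsilon)
      fix \<epsilon> :: real assume "0 < \<epsilon>"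
      obtain \<delta>2 where \<delta>2: "0 < \<delta>2"
        "\<And>q. q \<in> cadlag_from T t \<Longrightarrow> d_inf (path_upto X (t + h)) q < \<delta>2 \<Longrightarrow> \<bar>g q - g (path_upto X (t + h))\<bar> < \<epsilon>"
        using d_inf_continuous_onD[OF g_cont Y \<open>0 < \<epsilon>\<close>] by blast
      \<comment> \<open>The number of steps is chosen after \<open>h\<close> and \<open>X\<close>,
        so that the delay error \<open>K * (h / real m)\<close> falls below
        \<open>\<delta>2\<close>.\<close>
      obtain n where n: "K * h / \<delta>2 < real n"
        using reals_Archimedean2 by blast
      define m where "m = Suc n"
      have m: "0 < m" "K * (h / real m) < \<delta>2"
      proof -
        have "K * h / \<delta>2 < real m"
          using n by (simp add: m_def)
        then show "K * (h / real m) < \<delta>2"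
          using \<delta>2(1) by (simp add: m_def field_simps)
      qed (simp add: m_def)
      obtain Q where Q: "Q \<in> cadlag_at (t + h)" "\<And>r. r \<in> {0..t + h} \<Longrightarrow> norm (snd Q r - X r) \<le> K * (h / real m)"
        "\<bar>g Q - g p - time_deriv T g p * h - space_grad g p \<bullet> (X (t + h) - X t)\<bar> \<le> e' * (1 + CARD('d) * K) * h"
        using step_approximation[OF g p t(1) th h(1) K init lip near m(1)] by blast
      have "d_inf (path_upto X (t + h)) Q \<le> \<bar>fst (path_upto X (t + h)) - fst Q\<bar> + K * (h / real m)"
        using t h Q(2) cadlag_atD(1)[OF Q(1)] by (intro d_inf_le) (auto simp: norm_minus_commute)
      then have "d_inf (path_upto X (t + h)) Q < \<delta>2"
        using m cadlag_atD(1)[OF Q(1)] by simp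
      moreover have "Q \<in> cadlag_from T t"
        using th h by (intro cadlag_at_cadlag_from[OF Q(1)]) auto
      ultimately have "\<bar>g Q - g (path_upto X (t + h))\<bar> < \<epsilon>"
        by (intro \<delta>2)
      then show "\<bar>g (path_upto X (t + h)) - g p - time_deriv T g p * h - space_grad g p \<bullet> (X (t + h) - X t)\<bar> \<le> e * h + \<epsilon>"
        using Q(3) unfolding e'(2) by linarith
    qed
  qed
qed

section \<open>The viscosity inequalities\<close>

lemma inner_perturbation:
  fixes z f f' :: "'a::real_inner" and c c' :: real
  assumes "norm (f' - f) \<le> e" "\<bar>c' - c\<bar> \<le> e"
  shows "\<bar>(c' + z \<bullet> f') - (z \<bullet> f + c)\<bar> \<le> e * (1 + norm z)"
proof -
  have "\<bar>z \<bullet> (f' - f)\<bar> \<le> norm z * norm (f' - f)"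
    by (rule Cauchy_Schwarz_ineq2)
  also have "\<dots> \<le> norm z * e"
    using assms by (intro mult_left_mono) auto
  finally show ?thesis
    using assms(2) by (simp add: inner_diff_right algebra_simps)
qed

lemma nonneg_if_approx:
  fixes A C :: real
  assumes "0 \<le> C" "\<And>e. 0 < e \<Longrightarrow> 0 \<le> A + e * C"
  shows "0 \<le> A"
proof (rule field_le_epsilon)
  fix e :: real assume "0 < e"
  then have "0 \<le> A + e / (C + 1) * C"
    using assms(1) by (intro assms(2)) auto
  also have "\<dots> \<le> A + e"
    using \<open>0 < e\<close> assms(1) by (simp add: field_simps)
  finally show "0 \<le> A + e" .
qed

context control_problem
begin

text \<open>A single \<open>h\<close> works for all controls at once: it depends on the common speed
  \<open>K\<close>, on the uniform moduli of continuity of \<open>F\<close> and \<open>q\<close> at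
  \<open>p\<close>, and on the expansion along \<open>K\<close>-Lipschitz paths.\<close>

lemma local_expansion:
  assumes unif: "continuous_uniformly_in_control T F" "continuous_uniformly_in_control T q"
    and p: "p \<in> lip_paths T 0 \<mu> M" "fst p < T" "norm (snd p (fst p)) < M" and \<mu>: "L \<le> \<mu>"
    and g: "g \<in> C1_cadlag T (fst p)" and "0 < e"
  obtains h where "0 < h" "fst p + h < T"
    "\<And>u. u \<in> controls T (fst p) \<Longrightarrow> path_upto (traj p u) (fst p + h) \<in> lip_paths T (fst p) \<mu> M"
    "\<And>u. u \<in> controls T (fst p) \<Longrightarrow>
      \<bar>g (path_upto (traj p u) (fst p + h)) - g p - time_deriv T g p * h
        - space_grad g p \<bullet> (traj p u (fst p + h) - traj p u (fst p))\<bar> \<le> e * h"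
    "\<And>u \<sigma> v. u \<in> controls T (fst p) \<Longrightarrow> \<sigma> \<in> {fst p..fst p + h} \<Longrightarrow>
      norm (F (path_upto (traj p u) \<sigma>) v - F p v) \<le> e \<and> \<bar>q (path_upto (traj p u) \<sigma>) v - q p v\<bar> \<le> e"
proof -
  define t where "t = fst p"
  have p_in: "p \<in> cont_from T 0" and p_M: "sup_norm p \<le> M"
    and p_lip: "\<And>l r. 0 \<le> l \<Longrightarrow> l < r \<Longrightarrow> r \<le> t \<Longrightarrow> norm (snd p l - snd p r) \<le> \<mu> * (1 + M) * (r - l)"
    using p(1) by (auto simp: lip_paths_def t_def divide_le_eq)
  have t: "0 \<le> t" "t < T"
    using cont_fromD(1)[OF p_in] p(2) by (auto simp: t_def)
  have M: "0 < M"
    using p(3) norm_ge_zero[of "snd p (fst p)"] by linarith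
  define R where "R = 2 * (1 + M) * exp (2 * L * T)"
  define K where "K = L * (1 + (R - 1))"
  have "0 \<le> K"
    unfolding K_def R_def using M L_pos by simp
  have bound: "norm (traj p u r) \<le> R - 1" if "u \<in> controls T t" "r \<in> {0..T}" for u r
  proof -
    have "1 + norm (traj p u r) \<le> 2 * (1 + sup_norm p) * exp (2 * L * T)"
      using that by (intro trajectory_bound p_in) (auto simp: t_def)
    also have "\<dots> \<le> R"
      unfolding R_def using p_M by (intro mult_right_mono mult_left_mono) auto
    finally show ?thesis
      by simp
  qed
  have lip: "norm (traj p u r' - traj p u r) \<le> K * (r' - r)"
    if "u \<in> controls T t" "t \<le> r" "r \<le> r'" "r' \<le> T" for u r r'
    unfolding K_def using that bound by (intro trajectory_lipschitz p_in) (auto simp: t_def)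
  obtain \<delta>F where \<delta>F: "0 < \<delta>F" "\<And>p' v. p' \<in> cont_from T 0 \<Longrightarrow> d_inf p p' < \<delta>F \<Longrightarrow> dist (F p' v) (F p v) < e"
    using unif(1) p_in \<open>0 < e\<close> unfolding continuous_uniformly_in_control_def by meson
  obtain \<delta>q where \<delta>q: "0 < \<delta>q" "\<And>p' v. p' \<in> cont_from T 0 \<Longrightarrow> d_inf p p' < \<delta>q \<Longrightarrow> dist (q p' v) (q p v) < e"
    using unif(2) p_in \<open>0 < e\<close> unfolding continuous_uniformly_in_control_def by meson
  \<comment> \<open>The last term is the room between the end value and \<open>M\<close>; it is
    positive by the strict bound at the contact point, and a displacement below it keeps the
    trajectory in the ball of radius \<open>M\<close>.\<close>
  define \<delta> where "\<delta> = min (min \<delta>F \<delta>q) (M - norm (snd p t))"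
  have \<delta>: "0 < \<delta>" "\<delta> \<le> \<delta>F" "\<delta> \<le> \<delta>q" "\<delta> \<le> M - norm (snd p t)"
    using \<delta>F(1) \<delta>q(1) p(3) by (auto simp: \<delta>_def t_def)
  obtain \<eta> where \<eta>: "0 < \<eta>" "t + \<eta> < T"
    and taylor: "\<And>X h. continuous_on {0..T} X \<Longrightarrow> (\<And>r. r \<in> {0..t} \<Longrightarrow> X r = snd p r) \<Longrightarrow> 0 \<le> h \<Longrightarrow> h \<le> \<eta> \<Longrightarrow>
      (\<And>r r'. t \<le> r \<Longrightarrow> r \<le> r' \<Longrightarrow> r' \<le> t + h \<Longrightarrow> norm (X r' - X r) \<le> K * (r' - r)) \<Longrightarrow>
      \<bar>g (path_upto X (t + h)) - g p - time_deriv T g p * h - space_grad g p \<bullet> (X (t + h) - X t)\<bar> \<le> e * h"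
    using taylor_along_lipschitz[OF g cont_fromD(3)[OF p_in] _ p(2) \<open>0 \<le> K\<close> \<open>0 < e\<close>] t
    unfolding t_def by blast
  define h where "h = min \<eta> (\<delta> / (2 * (1 + K)))"
  have h: "0 < h" "h \<le> \<eta>" "t + h < T"
    using \<eta> \<delta> \<open>0 \<le> K\<close> by (auto simp: h_def)
  have "h * (1 + K) \<le> \<delta> / (2 * (1 + K)) * (1 + K)"
    using \<open>0 \<le> K\<close> by (intro mult_right_mono) (auto simp: h_def)
  also have "\<dots> = \<delta> / 2"
    using \<open>0 \<le> K\<close> by (simp add: field_simps)
  finally have h_\<delta>: "h + K * h < \<delta>"
    using \<delta>(1) by (simp add: algebra_simps)
  show ?thesis
  proof (rule that[of h])
    show "0 < h" "fst p + h < T"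
      using h by (auto simp: t_def)
    fix u :: "real \<Rightarrow> 'u" assume "u \<in> controls T (fst p)"
    then have u: "u \<in> controls T t"
      by (simp add: t_def)
    define X where "X = traj p u"
    have X: "continuous_on {0..T} X"
      unfolding X_def using p_in u by (intro trajectory_continuous) (auto simp: t_def)
    have init: "X r = snd p r" if "r \<in> {0..t}" for r
      unfolding X_def using p_in u that by (intro trajectory_initial) (auto simp: t_def)
    have X_M: "norm (X r) \<le> M" if r: "r \<in> {0..t + h}" for r
    proof (cases "r \<le> t")
      case True
      then have "norm (snd p r) \<le> sup_norm p"
        using r by (intro norm_le_sup_norm[OF cont_fromD(5)[OF p_in]]) (auto simp: t_def)
      then show ?thesis
        using init[of r] True r p_M by simp
    next
      case False
      have "norm (X r - X t) \<le> K * (r - t)"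
        unfolding X_def using False r h u by (intro lip) auto
      also have "\<dots> \<le> K * h"
        using r \<open>0 \<le> K\<close> by (intro mult_left_mono) auto
      finally have "norm (X r - X t) \<le> K * h" .
      then have "norm (X r) \<le> norm (X t) + K * h"
        using norm_triangle_sub[of "X r" "X t"] by linarith
      then show ?thesis
        using h_\<delta> \<delta>(4) h init[of t] t by simp
    qed
    \<comment> \<open>The speed bound is used twice: the crude \<open>K\<close> has just shown that
      \<open>X\<close> stays below \<open>M\<close>, and linear growth at \<open>M\<close> now gives
      the speed \<open>L * (1 + M)\<close>, at most \<open>\<mu> * (1 + M)\<close>.\<close>
    have X_\<mu>: "norm (X r' - X r) \<le> \<mu> * (1 + M) * (r' - r)" if r: "t \<le> r" "r \<le> r'" "r' \<le> t + h" for r r'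
    proof -
      have "norm (X r' - X r) \<le> L * (1 + M) * (r' - r)"
        using r h u X_M unfolding X_def by (intro trajectory_lipschitz p_in) (auto simp: t_def)
      also have "\<dots> \<le> \<mu> * (1 + M) * (r' - r)"
        using \<mu> M r by (intro mult_right_mono) auto
      finally show ?thesis .
    qed
    have steps: "norm (X l - X r) \<le> \<mu> * (1 + M) * (r - l)" if "0 \<le> l" "l < r" "r \<le> t + h" for l r
    proof -
      \<comment> \<open>When the interval straddles \<open>t\<close>, the bounds for the given path
        and for the trajectory have the same slope and add up to the bound for the whole
        interval.\<close>
      consider "r \<le> t" | "t \<le> l" | "l < t" "t < r"
        by linarith
      then show ?thesis
      proof cases
        case 1
        then show ?thesis
          using p_lip[of l r] init that by simp
      next
        case 2
        then show ?thesis
          using X_\<mu>[of l r] that by (simp add: norm_minus_commute)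
      next
        case 3
        have "norm (X l - X t) \<le> \<mu> * (1 + M) * (t - l)"
          using p_lip[of l t] init that 3 by simp
        moreover have "norm (X t - X r) \<le> \<mu> * (1 + M) * (r - t)"
          using X_\<mu>[of t r] that 3 by (simp add: norm_minus_commute)
        ultimately have "norm ((X l - X t) + (X t - X r)) \<le> \<mu> * (1 + M) * (t - l) + \<mu> * (1 + M) * (r - t)"
          by (rule norm_triangle_mono)
        then show ?thesis
          by (simp add: algebra_simps)
      qed
    qed
    have "path_upto X (t + h) \<in> lip_paths T t \<mu> M"
      unfolding lip_paths_def
    proof (intro CollectI conjI allI impI)
      show "path_upto X (t + h) \<in> cont_from T t"
        using h by (intro path_upto_cont_from[OF X]) auto
      show "sup_norm (path_upto X (t + h)) \<le> M"
        using t h X_M by (intro sup_norm_path_upto_le) auto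
      fix l r assume lr: "0 \<le> l \<and> l < r \<and> r \<le> fst (path_upto X (t + h))"
      then show "norm (snd (path_upto X (t + h)) l - snd (path_upto X (t + h)) r) / \<bar>l - r\<bar> \<le> \<mu> * (1 + M)"
        using steps[of l r] by (simp add: divide_le_eq)
    qed
    then show "path_upto (traj p u) (fst p + h) \<in> lip_paths T (fst p) \<mu> M"
      by (simp add: X_def t_def)
    have "\<bar>g (path_upto X (t + h)) - g p - time_deriv T g p * h - space_grad g p \<bullet> (X (t + h) - X t)\<bar> \<le> e * h"
      using lip[OF u] h by (intro taylor X init) (auto simp: X_def)
    then show "\<bar>g (path_upto (traj p u) (fst p + h)) - g p - time_deriv T g p * h
        - space_grad g p \<bullet> (traj p u (fst p + h) - traj p u (fst p))\<bar> \<le> e * h"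
      by (simp add: X_def t_def)
    fix \<sigma> v assume "\<sigma> \<in> {fst p..fst p + h}"
    then have \<sigma>: "t \<le> \<sigma>" "\<sigma> \<le> t + h"
      by (auto simp: t_def)
    have p_eq: "path_upto X t = p"
      using cont_fromD(3)[OF p_in] init by (intro path_upto_eqI) (auto simp: t_def)
    have K_h: "norm (X r - X r') \<le> K * h" if "r \<in> {t..\<sigma>}" "r' \<in> {t..\<sigma>}" for r r'
    proof -
      have "norm (X r - X r') \<le> K * \<bar>r - r'\<bar>"
        using lip[OF u, of r r'] lip[OF u, of r' r] that \<sigma> h
        by (cases "r \<le> r'") (auto simp: X_def norm_minus_commute)
      also have "\<dots> \<le> K * h"
        using that \<sigma> \<open>0 \<le> K\<close> by (intro mult_left_mono) auto
      finally show ?thesis .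
    qed
    have "d_inf p (path_upto X \<sigma>) \<le> (\<sigma> - t) + K * h"
      using d_inf_path_upto_le[of t \<sigma> X "K * h", OF K_h t(1) \<sigma>(1)] by (simp add: p_eq)
    then have "d_inf p (path_upto X \<sigma>) < \<delta>"
      using h_\<delta> \<sigma> by simp
    moreover have "path_upto X \<sigma> \<in> cont_from T 0"
      using \<sigma> t h by (intro path_upto_cont_from[OF X]) auto
    ultimately show "norm (F (path_upto (traj p u) \<sigma>) v - F p v) \<le> e \<and> \<bar>q (path_upto (traj p u) \<sigma>) v - q p v\<bar> \<le> e"
      using \<delta>F(2)[of "path_upto X \<sigma>" v] \<delta>q(2)[of "path_upto X \<sigma>" v] \<delta>
      by (simp add: X_def dist_norm)
  qed
qed

section \<open>The Hamiltonian and the passage to the limit in the time step\<close>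

lemma hamiltonian_le:
  assumes p: "p \<in> cont_from T 0"
  shows "hamiltonian F q p z \<le> z \<bullet> F p v + q p v"
  unfolding hamiltonian_def
proof (rule cINF_lower)
  define B where "B = L * (1 + sup_norm p)"
  have "- (norm z * B) - B \<le> z \<bullet> F p u + q p u" for u
  proof -
    have "norm (F p u) \<le> B" "norm (q p u) \<le> B"
      using F q cont_fromD(1-3)[OF p] unfolding lipschitz_integrand_def B_def by auto
    moreover have "\<bar>z \<bullet> F p u\<bar> \<le> norm z * norm (F p u)"
      by (rule Cauchy_Schwarz_ineq2)
    moreover have "norm z * norm (F p u) \<le> norm z * B"
      using calculation by (intro mult_left_mono) auto
    ultimately show ?thesis
      by (auto simp: abs_le_iff)
  qed
  then show "bdd_below (range (\<lambda>u. z \<bullet> F p u + q p u))"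
    by (auto intro!: bdd_belowI)
qed simp

text \<open>Running cost plus first-order space term is the integral of the expression minimised in
  the Hamiltonian, evaluated along the trajectory.\<close>

lemma running_cost_plus_inner:
  assumes p: "p \<in> cont_from T 0" and u: "u \<in> controls T (fst p)" and s: "fst p \<le> s" "s \<le> T"
  defines "X \<equiv> traj p u"
  shows "running_cost p u (fst p) s + z \<bullet> (X s - X (fst p))
      = integral {fst p..s} (\<lambda>\<sigma>. q (path_upto X \<sigma>) (u \<sigma>) + z \<bullet> F (path_upto X \<sigma>) (u \<sigma>))"
    and "(\<lambda>\<sigma>. q (path_upto X \<sigma>) (u \<sigma>) + z \<bullet> F (path_upto X \<sigma>) (u \<sigma>)) integrable_on {fst p..s}"
proof -
  have F': "(\<lambda>\<sigma>. F (path_upto X \<sigma>) (u \<sigma>)) integrable_on {fst p..s}"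
    and q': "(\<lambda>\<sigma>. q (path_upto X \<sigma>) (u \<sigma>)) integrable_on {fst p..s}"
    unfolding X_def using p u s by (auto intro: trajectory_integrable[OF F] trajectory_integrable[OF q])
  have z: "(\<lambda>\<sigma>. z \<bullet> F (path_upto X \<sigma>) (u \<sigma>)) integrable_on {fst p..s}"
    "integral {fst p..s} (\<lambda>\<sigma>. z \<bullet> F (path_upto X \<sigma>) (u \<sigma>)) = z \<bullet> (X s - X (fst p))"
    using integrable_linear[OF F' bounded_linear_inner_right[of z]]
      integral_linear[OF F' bounded_linear_inner_right[of z]]
      trajectory_increment[OF p u order.refl s] by (auto simp: o_def X_def)
  show "(\<lambda>\<sigma>. q (path_upto X \<sigma>) (u \<sigma>) + z \<bullet> F (path_upto X \<sigma>) (u \<sigma>)) integrable_on {fst p..s}"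
    using q' z by (intro integrable_add)
  show "running_cost p u (fst p) s + z \<bullet> (X s - X (fst p))
      = integral {fst p..s} (\<lambda>\<sigma>. q (path_upto X \<sigma>) (u \<sigma>) + z \<bullet> F (path_upto X \<sigma>) (u \<sigma>))"
    using Henstock_Kurzweil_Integration.integral_add[OF q' z(1)] z(2) by (simp add: X_def)
qed

text \<open>For each constant control \<open>v\<close>, dynamic programming bounds
  \<open>V p\<close>, and \<open>g\<close> touches \<open>V\<close> from above on the invariant
  class, so \<open>V\<close> at the end of the step may be replaced by \<open>g\<close>. Expanding
  \<open>g\<close> and freezing the coefficients at \<open>p\<close> gives the inequality for
  \<open>v\<close>; the infimum over \<open>v\<close> comes last.\<close>

lemma value_subsolution:
  assumes unif: "continuous_uniformly_in_control T F" "continuous_uniformly_in_control T q"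
    and \<mu>: "L \<le> \<mu>"
  shows "viscosity_mu_subsolution T (hamiltonian F q) \<phi> \<mu> V"
  unfolding viscosity_mu_subsolution_def
proof (intro conjI ballI allI impI value_continuous)
  show "V p \<le> \<phi> p" if "p \<in> cont_at T" for p
    using value_terminal[OF that] by simp
  fix M p \<psi> g
  assume p: "p \<in> lip_paths T 0 \<mu> M" "fst p < T" "norm (snd p (fst p)) < M"
    and \<psi>: "\<psi> \<in> J_plus T \<mu> M p V" and g: "g \<in> C1_extensions T (fst p) \<psi>"
  have g_C1: "g \<in> C1_cadlag T (fst p)"
    and g_\<psi>: "\<And>\<eta>. \<eta> \<in> cont_from T (fst p) \<Longrightarrow> g \<eta> = \<psi> \<eta>"
    using g by (auto simp: C1_extensions_def)
  have p_in: "p \<in> cont_from T 0"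
    using p(1) by (simp add: lip_paths_def)
  have g_p: "g p = V p"
    using \<psi> g_\<psi>[of p] cont_at_cont_from[OF cont_fromD(3)[OF p_in], of "fst p" T] p(2)
    by (simp add: J_plus_def)
  have V_le: "V \<eta> \<le> g \<eta>" if \<eta>: "\<eta> \<in> lip_paths T (fst p) \<mu> M" for \<eta>
  proof -
    have "ereal (V \<eta> - \<psi> \<eta>) \<le> (SUP \<eta>\<in>lip_paths T (fst p) \<mu> M. ereal (V \<eta> - \<psi> \<eta>))"
      using \<eta> by (rule SUP_upper)
    then show ?thesis
      using \<psi> g_\<psi>[of \<eta>] \<eta> by (simp add: J_plus_def lip_paths_def)
  qed
  define a where "a = time_deriv T g p"
  define b where "b = space_grad g p"
  have "- a \<le> b \<bullet> F p v + q p v" for v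
  proof -
    have "0 \<le> a + (b \<bullet> F p v + q p v)"
    proof (rule nonneg_if_approx)
      fix e :: real assume "0 < e"
      obtain h where h: "0 < h" "fst p + h < T"
        and in_lip: "\<And>u. u \<in> controls T (fst p) \<Longrightarrow> path_upto (traj p u) (fst p + h) \<in> lip_paths T (fst p) \<mu> M"
        and taylor: "\<And>u. u \<in> controls T (fst p) \<Longrightarrow>
          \<bar>g (path_upto (traj p u) (fst p + h)) - g p - a * h
            - b \<bullet> (traj p u (fst p + h) - traj p u (fst p))\<bar> \<le> e * h"
        and close: "\<And>u \<sigma> v. u \<in> controls T (fst p) \<Longrightarrow> \<sigma> \<in> {fst p..fst p + h} \<Longrightarrow>
          norm (F (path_upto (traj p u) \<sigma>) v - F p v) \<le> e \<and> \<bar>q (path_upto (traj p u) \<sigma>) v - q p v\<bar> \<le> e"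
        unfolding a_def b_def using local_expansion[OF unif p \<mu> g_C1 \<open>0 < e\<close>] by blast
      define u where "u = (\<lambda>_::real. v)"
      define s where "s = fst p + h"
      have u: "u \<in> controls T (fst p)"
        unfolding u_def by (rule controls_const)
      have s: "fst p \<le> s" "s \<le> T"
        using h by (auto simp: s_def)
      have "V p \<le> running_cost p u (fst p) s + V (path_upto (traj p u) s)"
        by (rule value_dpp_le[OF p_in u s])
      also have "\<dots> \<le> running_cost p u (fst p) s + g (path_upto (traj p u) s)"
        using V_le[OF in_lip[OF u]] by (simp add: s_def)
      also have "\<dots> \<le> running_cost p u (fst p) s + b \<bullet> (traj p u s - traj p u (fst p)) + g p + a * h + e * h"
        using taylor[OF u] unfolding s_def by linarith
      also have "running_cost p u (fst p) s + b \<bullet> (traj p u s - traj p u (fst p))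
          \<le> integral {fst p..s} (\<lambda>_. (b \<bullet> F p v + q p v) + e * (1 + norm b))"
        unfolding running_cost_plus_inner(1)[OF p_in u s]
      proof (rule integral_le[OF running_cost_plus_inner(2)[OF p_in u s]])
        fix \<sigma> assume "\<sigma> \<in> {fst p..s}"
        then show "q (path_upto (traj p u) \<sigma>) (u \<sigma>) + b \<bullet> F (path_upto (traj p u) \<sigma>) (u \<sigma>)
            \<le> (b \<bullet> F p v + q p v) + e * (1 + norm b)"
          using close[OF u, of \<sigma> v]
            inner_perturbation[of "F (path_upto (traj p u) \<sigma>) v" "F p v" e "q (path_upto (traj p u) \<sigma>) v" "q p v" b]
          by (simp add: s_def u_def)
      qed auto
      also have "\<dots> = h * ((b \<bullet> F p v + q p v) + e * (1 + norm b))"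
        using h by (simp add: s_def)
      \<comment> \<open>In \<open>2 + norm b\<close>, one unit is the expansion error of
        \<open>g\<close>, and \<open>1 + norm b\<close> comes from replacing \<open>q\<close> and
        \<open>F\<close> by their values at \<open>p\<close>.\<close>
      finally have "0 \<le> h * (a + (b \<bullet> F p v + q p v) + e * (2 + norm b))"
        unfolding g_p by (simp add: algebra_simps)
      then show "0 \<le> a + (b \<bullet> F p v + q p v) + e * (2 + norm b)"
        using h(1) by (simp add: zero_le_mult_iff)
    qed simp
    then show ?thesis
      by simp
  qed
  then have "- a \<le> hamiltonian F q p b"
    unfolding hamiltonian_def by (intro cINF_greatest) auto
  then show "0 \<le> time_deriv T g p + hamiltonian F q p (space_grad g p)"
    by (simp add: a_def b_def)
qed

lemma value_supersolution:
  assumes unif: "continuous_uniformly_in_control T F" "continuous_uniformly_in_control T q"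
    and \<mu>: "L \<le> \<mu>"
  shows "viscosity_mu_supersolution T (hamiltonian F q) \<phi> \<mu> V"
  unfolding viscosity_mu_supersolution_def
proof (intro conjI ballI allI impI value_continuous)
  show "\<phi> p \<le> V p" if "p \<in> cont_at T" for p
    using value_terminal[OF that] by simp
  fix M p \<psi> g
  assume p: "p \<in> lip_paths T 0 \<mu> M" "fst p < T" "norm (snd p (fst p)) < M"
    and \<psi>: "\<psi> \<in> J_minus T \<mu> M p V" and g: "g \<in> C1_extensions T (fst p) \<psi>"
  have g_C1: "g \<in> C1_cadlag T (fst p)"
    and g_\<psi>: "\<And>\<eta>. \<eta> \<in> cont_from T (fst p) \<Longrightarrow> g \<eta> = \<psi> \<eta>"
    using g by (auto simp: C1_extensions_def)
  have p_in: "p \<in> cont_from T 0"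
    using p(1) by (simp add: lip_paths_def)
  have g_p: "V p = - g p"
    using \<psi> g_\<psi>[of p] cont_at_cont_from[OF cont_fromD(3)[OF p_in], of "fst p" T] p(2)
    by (simp add: J_minus_def)
  have V_ge: "- g \<eta> \<le> V \<eta>" if \<eta>: "\<eta> \<in> lip_paths T (fst p) \<mu> M" for \<eta>
  proof -
    have "(INF \<eta>\<in>lip_paths T (fst p) \<mu> M. ereal (V \<eta> + \<psi> \<eta>)) \<le> ereal (V \<eta> + \<psi> \<eta>)"
      using \<eta> by (rule INF_lower)
    then show ?thesis
      using \<psi> g_\<psi>[of \<eta>] \<eta> by (simp add: J_minus_def lip_paths_def)
  qed
  define a where "a = time_deriv T g p"
  \<comment> \<open>The functional touching \<open>V\<close> from below is \<open>- g\<close>, hence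
    the sign.\<close>
  define b where "b = - space_grad g p"
  have "0 \<le> a - hamiltonian F q p b"
  proof (rule nonneg_if_approx)
    fix e :: real assume "0 < e"
    obtain h where h: "0 < h" "fst p + h < T"
      and in_lip: "\<And>u. u \<in> controls T (fst p) \<Longrightarrow> path_upto (traj p u) (fst p + h) \<in> lip_paths T (fst p) \<mu> M"
      and taylor: "\<And>u. u \<in> controls T (fst p) \<Longrightarrow>
        \<bar>g (path_upto (traj p u) (fst p + h)) - g p - a * h
          - space_grad g p \<bullet> (traj p u (fst p + h) - traj p u (fst p))\<bar> \<le> e * h"
      and close: "\<And>u \<sigma> v. u \<in> controls T (fst p) \<Longrightarrow> \<sigma> \<in> {fst p..fst p + h} \<Longrightarrow>
        norm (F (path_upto (traj p u) \<sigma>) v - F p v) \<le> e \<and> \<bar>q (path_upto (traj p u) \<sigma>) v - q p v\<bar> \<le> e"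
      unfolding a_def using local_expansion[OF unif p \<mu> g_C1 \<open>0 < e\<close>] by blast
    define s where "s = fst p + h"
    have s: "fst p \<le> s" "s \<le> T"
      using h by (auto simp: s_def)
    \<comment> \<open>Optimality up to \<open>e * h\<close> leaves an error \<open>e\<close> after
      division by \<open>h\<close>. The control depends on \<open>h\<close>, which is harmless
      because \<open>h\<close> was fixed for all controls.\<close>
    obtain u where u: "u \<in> controls T (fst p)"
      and near: "running_cost p u (fst p) s + V (path_upto (traj p u) s) < V p + e * h"
      using value_dpp_ge[OF p_in s, of "e * h"] \<open>0 < e\<close> h(1) by auto
    have "h * (hamiltonian F q p b - e * (1 + norm b))
        = integral {fst p..s} (\<lambda>_. hamiltonian F q p b - e * (1 + norm b))"
      using h by (simp add: s_def)
    also have "\<dots> \<le> running_cost p u (fst p) s + b \<bullet> (traj p u s - traj p u (fst p))"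
      unfolding running_cost_plus_inner(1)[OF p_in u s]
    proof (rule integral_le[OF _ running_cost_plus_inner(2)[OF p_in u s]])
      fix \<sigma> assume "\<sigma> \<in> {fst p..s}"
      then show "hamiltonian F q p b - e * (1 + norm b)
          \<le> q (path_upto (traj p u) \<sigma>) (u \<sigma>) + b \<bullet> F (path_upto (traj p u) \<sigma>) (u \<sigma>)"
        using close[OF u, of \<sigma> "u \<sigma>"] hamiltonian_le[OF p_in, of b "u \<sigma>"]
          inner_perturbation[of "F (path_upto (traj p u) \<sigma>) (u \<sigma>)" "F p (u \<sigma>)" e
            "q (path_upto (traj p u) \<sigma>) (u \<sigma>)" "q p (u \<sigma>)" b]
        by (simp add: s_def abs_le_iff)
    qed auto
    also have "\<dots> \<le> running_cost p u (fst p) s - g (path_upto (traj p u) s) + g p + a * h + e * h"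
      using taylor[OF u] unfolding s_def b_def inner_minus_left by linarith
    also have "\<dots> \<le> running_cost p u (fst p) s + V (path_upto (traj p u) s) + g p + a * h + e * h"
      using V_ge[OF in_lip[OF u]] by (simp add: s_def)
    also have "\<dots> \<le> a * h + 2 * (e * h)"
      using near g_p by simp
    \<comment> \<open>Compared with the subsolution case, the additional unit in
      \<open>3 + norm b\<close> is the loss from near optimality.\<close>
    finally have "0 \<le> h * (a - hamiltonian F q p b + e * (3 + norm b))"
      by (simp add: algebra_simps)
    then show "0 \<le> a - hamiltonian F q p b + e * (3 + norm b)"
      using h(1) by (simp add: zero_le_mult_iff)
  qed simp
  then show "- time_deriv T g p + hamiltonian F q p (- space_grad g p) \<le> 0"
    by (simp add: a_def b_def)
qed

end

theorem theorem4p5: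
  fixes T :: real
    and F :: "('d::finite) path \<Rightarrow> 'u::metric_space \<Rightarrow> real^'d"
    and q :: "'d path \<Rightarrow> 'u \<Rightarrow> real"
    and \<phi> :: "'d path \<Rightarrow> real"
  assumes "T > 0"
    and "hypothesis_H T F q \<phi>"
    and "continuous_uniformly_in_control T F"
    and "continuous_uniformly_in_control T q"
  shows "viscosity_solution T (hamiltonian F q) \<phi> (value_functional T F q \<phi>)"
proof -
  have cont: "jointly_continuous T F" "jointly_continuous T q"
    using assms(2) by (auto simp: hypothesis_H_def)
  obtain L where "0 < L"
    and lip: "\<forall>t\<in>{0..T}. \<forall>p\<in>cont_at t. \<forall>p'\<in>cont_at t. \<forall>u.
      max (norm (F p u - F p' u)) \<bar>q p u - q p' u\<bar> \<le> L * sup_norm (t, \<lambda>r. snd p r - snd p' r)"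
    and growth: "\<forall>t\<in>{0..T}. \<forall>p\<in>cont_at t. \<forall>u. max (norm (F p u)) \<bar>q p u\<bar> \<le> L * (1 + sup_norm p)"
    and phi: "\<forall>p\<in>cont_at T. \<forall>p'\<in>cont_at T. \<bar>\<phi> p - \<phi> p'\<bar> \<le> L * sup_norm (T, \<lambda>r. snd p r - snd p' r)"
      "\<forall>p\<in>cont_at T. \<bar>\<phi> p\<bar> \<le> L * (1 + sup_norm p)"
    using assms(2) unfolding hypothesis_H_def by (elim conjE exE)
  have L: "control_problem T L F q \<phi>"
  proof
    show "lipschitz_integrand T L F" "lipschitz_integrand T L q"
      using cont lip growth by (auto simp: lipschitz_integrand_def)
  qed (use assms(1) \<open>0 < L\<close> phi in blast)+
  \<comment> \<open>The constant \<open>L\<close> serves as threshold \<open>\<mu>\<^sub>0\<close>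
    for both inequalities.\<close>
  show ?thesis
    unfolding viscosity_solution_def
    using \<open>0 < L\<close> control_problem.value_subsolution[OF L assms(3,4)]
      control_problem.value_supersolution[OF L assms(3,4)] by auto
qed

end
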